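(* Let $J\subset S$ be a square-free monomial ideal such that the Stanley–Reisner complex $\Delta(J)$ is shellable, and let $Z=\mathrm{MultiProj}(S/J)\subset\mathbb{P}=\mathrm{MultiProj}(S)$. Then for every $\mathbf{n}\in\mathrm{HSupp}_{\mathbb{P}}(Z)$ there is an increasing lattice path from $\mathbf{n}$ to a vector $\mathbf{a}\in\mathrm{MSupp}_{\mathbb{P}}(Z)$.
   Context: $\Bbbk$ is a field and $S=\Bbbk[x_1,\ldots,x_n]$ is a standard $\mathbb{N}^p$-graded polynomial ring, i.e. $\deg(x_i)\in\{\mathbf{e}_1,\ldots,\mathbf{e}_p\}$ for each $i$. The multigraded Hilbert polynomial $P_{S/J}(\mathbf{t})\in\mathbb{Q}[t_1,\ldots,t_p]$ satisfies $P_{S/J}(\mathbf{v})=\dim_\Bbbk([S/J]_{\mathbf{v}})$ for $\mathbf{v}\gg\mathbf{0}$; write uniquely $P_{S/J}(\mathbf{t})=\sum_{\mathbf{n}\in\mathbb{N}^p}\deg_{\mathbb{P}}^{\mathbf{n}}(Z)\prod_{i=1}^p\binom{t_i+n_i}{n_i}$. Set $\mathrm{HSupp}_{\mathbb{P}}(Z)=\{\mathbf{n}\in\mathbb{N}^p\mid\deg_{\mathbb{P}}^{\mathbf{n}}(Z)\ne0\}$ and $\mathrm{MSupp}_{\mathbb{P}}(Z)=\{\mathbf{n}\in\mathrm{HSupp}_{\mathbb{P}}(Z)\mid n_1+\cdots+n_p=\dim(Z)\}$. A simplicial complex is shellable if it is pure and its facets can be ordered $F_1,\ldots,F_k$ so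 that $\langle F_1,\ldots,F_{i-1}\rangle\cap\langle F_i\rangle$ is pure of dimension $\dim(F_i)-1$ for all $2\le i\le k$. A sequence of lattice points $\mathbf{a}_1,\ldots,\mathbf{a}_u\in\mathbb{N}^p$ is an increasing lattice path (from $\mathbf{a}_1$ to $\mathbf{a}_u$) if for every $1\le j\le u-1$ we have $\mathbf{a}_{j+1}-\mathbf{a}_j=\mathbf{e}_i$ for some $i\in\{1,\ldots,p\}$. *)

theory Defs
  imports
    "HOL-Analysis.Analysis"
    "HOL-Library.Poly_Mapping"
    "HOL-Algebra.Embedded_Algebras"
    "HOL-Algebra.QuotRing"
    "HOL-Algebra.Algebraic_Closure_Type"
begin

section \<open>Polynomials in finitely many variables\<close>

text \<open>
  A polynomial is a finitely supported family of coefficients indexed by monomials, a monomial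
  being a finitely supported family of exponents. The variables are indexed by the elements of a
  finite type. The ring structure is the library's convolution product.
\<close>

type_synonym ('x, 'k) mpoly = "('x \<Rightarrow>\<^sub>0 nat) \<Rightarrow>\<^sub>0 'k"

abbreviation mpoly_ring :: "('x, 'k::field) mpoly ring"
  where "mpoly_ring \<equiv> ring_of_type_algebra"

definition eval_mpoly :: "('p::finite, 'k::comm_ring_1) mpoly \<Rightarrow> 'k ^ 'p \<Rightarrow> 'k"
  where "eval_mpoly P t =
    (\<Sum>m\<in>Poly_Mapping.keys P.
       Poly_Mapping.lookup P m * (\<Prod>i\<in>UNIV. (t $ i) ^ Poly_Mapping.lookup m i))"


section \<open>Multigraded algebras\<close>

text \<open>
  An \<open>\<nat>\<^sup>p\<close>-graded algebra is given by a ring \<open>R\<close>, the field \<open>K \<subseteq> carrier R\<close> of scalars and the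
  family \<open>gr\<close> of graded pieces. The standard basis vector \<open>\<^bold>e\<^sub>j\<close> is \<open>axis j 1\<close>.
  The irrelevant ideal is generated by the pieces whose degree is positive in every coordinate, and
  \<open>multiproj\<close> is the underlying set of the multiprojective scheme: the homogeneous primes which
  do not contain the irrelevant ideal.
\<close>

definition homogeneous_ideal ::
    "'r ring \<Rightarrow> (nat ^ 'p::finite \<Rightarrow> 'r set) \<Rightarrow> 'r set \<Rightarrow> bool"
  where "homogeneous_ideal R gr I \<longleftrightarrow> ideal I R \<and> I = genideal R (I \<inter> (\<Union>v. gr v))"

definition irrelevant_ideal :: "'r ring \<Rightarrow> (nat ^ 'p::finite \<Rightarrow> 'r set) \<Rightarrow> 'r set"
  where "irrelevant_ideal R gr = genideal R (\<Union>v\<in>{v. \<forall>j. 0 < v $ j}. gr v)"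

definition multiproj :: "'r ring \<Rightarrow> (nat ^ 'p::finite \<Rightarrow> 'r set) \<Rightarrow> 'r set set"
  where "multiproj R gr =
    {P. primeideal P R \<and> homogeneous_ideal R gr P \<and> \<not> irrelevant_ideal R gr \<subseteq> P}"

definition hilbert_function ::
    "'r ring \<Rightarrow> 'r set \<Rightarrow> (nat ^ 'p::finite \<Rightarrow> 'r set) \<Rightarrow> nat ^ 'p \<Rightarrow> nat"
  where "hilbert_function R K gr v = ring.dim R K (gr v)"

definition hilbert_polynomial ::
    "'r ring \<Rightarrow> 'r set \<Rightarrow> (nat ^ 'p::finite \<Rightarrow> 'r set) \<Rightarrow> ('p, rat) mpoly"
  where "hilbert_polynomial R K gr =
    (THE P. \<exists>v0. \<forall>v\<ge>v0.
       eval_mpoly P (\<chi> i. of_nat (v $ i)) = of_nat (hilbert_function R K gr v))"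

text \<open>
  The coefficients of a rational polynomial in the basis of products of binomials
  \<open>\<Prod>\<^sub>i (t\<^sub>i + n\<^sub>i choose n\<^sub>i)\<close>. As \<open>\<rat>\<close> is infinite, the identity of polynomials is the
  identity of polynomial functions on \<open>\<rat>\<^sup>p\<close>.
\<close>

definition binomial_coeffs :: "('p::finite, rat) mpoly \<Rightarrow> nat ^ 'p \<Rightarrow> rat"
  where "binomial_coeffs P =
    (THE c. finite {n. c n \<noteq> 0} \<and>
       (\<forall>t. eval_mpoly P t =
          (\<Sum>n | c n \<noteq> 0. c n * (\<Prod>i\<in>UNIV. (t $ i + of_nat (n $ i)) gchoose (n $ i)))))"


section \<open>Topological dimension\<close>

definition zariski_topology :: "'r ring \<Rightarrow> 'r set topology"
  where "zariski_topology R =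
    topology (\<lambda>U. \<exists>T\<subseteq>carrier R. U = {P. primeideal P R \<and> \<not> T \<subseteq> P})"

lemma istopology_zariski:
  "istopology (\<lambda>U. \<exists>T\<subseteq>carrier R. U = {P. primeideal P R \<and> \<not> T \<subseteq> P})"
  unfolding istopology_def
proof (intro conjI allI impI)
  fix U V
  assume "\<exists>T\<subseteq>carrier R. U = {P. primeideal P R \<and> \<not> T \<subseteq> P}"
    and "\<exists>T\<subseteq>carrier R. V = {P. primeideal P R \<and> \<not> T \<subseteq> P}"
  then obtain A B where A: "A \<subseteq> carrier R" "U = {P. primeideal P R \<and> \<not> A \<subseteq> P}"
    and B: "B \<subseteq> carrier R" "V = {P. primeideal P R \<and> \<not> B \<subseteq> P}" by blast
  let ?C = "{a \<otimes>\<^bsub>R\<^esub> b | a b. a \<in> A \<and> b \<in> B} \<inter> carrier R"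
  have *: "\<not> ?C \<subseteq> P \<longleftrightarrow> \<not> A \<subseteq> P \<and> \<not> B \<subseteq> P" if P: "primeideal P R" for P
  proof -
    interpret primeideal P R by (fact P)
    show ?thesis
    proof
      assume "\<not> ?C \<subseteq> P"
      then obtain a b where "a \<in> A" "b \<in> B" "a \<otimes>\<^bsub>R\<^esub> b \<notin> P" by blast
      with A(1) B(1) show "\<not> A \<subseteq> P \<and> \<not> B \<subseteq> P" using I_l_closed I_r_closed by blast
    next
      assume "\<not> A \<subseteq> P \<and> \<not> B \<subseteq> P"
      then obtain a b where ab: "a \<in> A" "b \<in> B" "a \<notin> P" "b \<notin> P" by blast
      with A(1) B(1) I_prime[of a b] have "a \<otimes>\<^bsub>R\<^esub> b \<notin> P" "a \<otimes>\<^bsub>R\<^esub> b \<in> carrier R" by blast+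
      with ab show "\<not> ?C \<subseteq> P" by blast
    qed
  qed
  have "U \<inter> V = {P. primeideal P R \<and> \<not> ?C \<subseteq> P}"
    using A(2) B(2) * by blast
  then show "\<exists>T\<subseteq>carrier R. U \<inter> V = {P. primeideal P R \<and> \<not> T \<subseteq> P}" by blast
next
  fix \<U>
  assume "\<forall>U\<in>\<U>. \<exists>T\<subseteq>carrier R. U = {P. primeideal P R \<and> \<not> T \<subseteq> P}"
  then obtain T where T: "\<And>U. U \<in> \<U> \<Longrightarrow> T U \<subseteq> carrier R"
      "\<And>U. U \<in> \<U> \<Longrightarrow> U = {P. primeideal P R \<and> \<not> T U \<subseteq> P}" by metis
  have "\<Union> \<U> = {P. primeideal P R \<and> \<not> (\<Union>U\<in>\<U>. T U) \<subseteq> P}"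
    using T(2) by blast
  with T(1) show "\<exists>T\<subseteq>carrier R. \<Union> \<U> = {P. primeideal P R \<and> \<not> T \<subseteq> P}" by blast
qed

lemma openin_zariski:
  "openin (zariski_topology R) U \<longleftrightarrow>
     (\<exists>T\<subseteq>carrier R. U = {P. primeideal P R \<and> \<not> T \<subseteq> P})"
  unfolding zariski_topology_def by (simp add: topology_inverse'[OF istopology_zariski])

definition irreducible_closed :: "'a topology \<Rightarrow> 'a set \<Rightarrow> bool"
  where "irreducible_closed T Y \<longleftrightarrow> closedin T Y \<and> Y \<noteq> {} \<and>
    (\<forall>C D. closedin T C \<and> closedin T D \<and> Y = C \<union> D \<longrightarrow> Y = C \<or> Y = D)"

text \<open>Supremum of the lengths of chains of irreducible closed subsets; \<open>-\<infinity>\<close> for the empty space.\<close>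

definition krull_dim :: "'a topology \<Rightarrow> ereal"
  where "krull_dim T =
    Sup {ereal (real m) | m. \<exists>Y::nat \<Rightarrow> 'a set.
       (\<forall>i\<le>m. irreducible_closed T (Y i)) \<and> (\<forall>i<m. Y i \<subset> Y (Suc i))}"

definition multiproj_space ::
    "'r ring \<Rightarrow> (nat ^ 'p::finite \<Rightarrow> 'r set) \<Rightarrow> 'r set topology"
  where "multiproj_space R gr = subtopology (zariski_topology R) (multiproj R gr)"


section \<open>Quotients of a standard multigraded polynomial ring\<close>

text \<open>The vector \<open>d i\<close> is the degree of the variable \<open>x\<^sub>i\<close>.\<close>

definition standard_grading :: "('x::finite \<Rightarrow> nat ^ 'p::finite) \<Rightarrow> bool"
  where "standard_grading d \<longleftrightarrow> (\<forall>i. \<exists>j. d i = axis j 1)"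

definition monomial_degree ::
    "('x::finite \<Rightarrow> nat ^ 'p::finite) \<Rightarrow> ('x \<Rightarrow>\<^sub>0 nat) \<Rightarrow> nat ^ 'p"
  where "monomial_degree d m = (\<Sum>i\<in>UNIV. Poly_Mapping.lookup m i *s d i)"

definition mpoly_piece ::
    "('x::finite \<Rightarrow> nat ^ 'p::finite) \<Rightarrow> nat ^ 'p \<Rightarrow> ('x, 'k::field) mpoly set"
  where "mpoly_piece d v = {f. \<forall>m\<in>Poly_Mapping.keys f. monomial_degree d m = v}"

definition quot_ring :: "('x::finite, 'k::field) mpoly set \<Rightarrow> ('x, 'k) mpoly set ring"
  where "quot_ring J = mpoly_ring Quot J"

definition quot_scalars :: "('x::finite, 'k::field) mpoly set \<Rightarrow> ('x, 'k) mpoly set set"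
  where "quot_scalars J = range (\<lambda>c. J +>\<^bsub>mpoly_ring\<^esub> Poly_Mapping.single 0 c)"

definition quot_piece ::
    "('x::finite \<Rightarrow> nat ^ 'p::finite) \<Rightarrow> ('x, 'k::field) mpoly set \<Rightarrow> nat ^ 'p
      \<Rightarrow> ('x, 'k) mpoly set set"
  where "quot_piece d J v = (\<lambda>f. J +>\<^bsub>mpoly_ring\<^esub> f) ` mpoly_piece d v"

text \<open>In the following, \<open>Z = MultiProj(S/J)\<close>.\<close>

definition multidegree ::
    "('x::finite \<Rightarrow> nat ^ 'p::finite) \<Rightarrow> ('x, 'k::field) mpoly set \<Rightarrow> nat ^ 'p \<Rightarrow> rat"
  where "multidegree d J =
    binomial_coeffs (hilbert_polynomial (quot_ring J) (quot_scalars J) (quot_piece d J))"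

definition dim_multiproj ::
    "('x::finite \<Rightarrow> nat ^ 'p::finite) \<Rightarrow> ('x, 'k::field) mpoly set \<Rightarrow> ereal"
  where "dim_multiproj d J = krull_dim (multiproj_space (quot_ring J) (quot_piece d J))"

definition HSupp ::
    "('x::finite \<Rightarrow> nat ^ 'p::finite) \<Rightarrow> ('x, 'k::field) mpoly set \<Rightarrow> (nat ^ 'p) set"
  where "HSupp d J = {n. multidegree d J n \<noteq> 0}"

definition MSupp ::
    "('x::finite \<Rightarrow> nat ^ 'p::finite) \<Rightarrow> ('x, 'k::field) mpoly set \<Rightarrow> (nat ^ 'p) set"
  where "MSupp d J = {n \<in> HSupp d J. ereal (real (\<Sum>j\<in>UNIV. n $ j)) = dim_multiproj d J}"


section \<open>Simplicial complexes and Stanley--Reisner ideals\<close>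

text \<open>A simplicial complex is represented by the set of all its faces, the empty face included.\<close>

definition facets :: "'x set set \<Rightarrow> 'x set set"
  where "facets \<Delta> = {F \<in> \<Delta>. \<forall>G\<in>\<Delta>. F \<subseteq> G \<longrightarrow> F = G}"

definition face_dim :: "'x set \<Rightarrow> int"
  where "face_dim F = int (card F) - 1"

definition pure_of_dim :: "'x set set \<Rightarrow> int \<Rightarrow> bool"
  where "pure_of_dim \<Delta> e \<longleftrightarrow> (\<forall>F\<in>facets \<Delta>. face_dim F = e)"

definition generated_complex :: "'x set set \<Rightarrow> 'x set set"
  where "generated_complex \<F> = {G. \<exists>F\<in>\<F>. G \<subseteq> F}"

text \<open>
  Facets are listed from index 0. The intersections below always contain the empty face, so that
  they have a facet and the purity condition is never void.
\<close>

definition shellable :: "'x set set \<Rightarrow> bool"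
  where "shellable \<Delta> \<longleftrightarrow> (\<exists>e. pure_of_dim \<Delta> e) \<and>
    (\<exists>Fs. distinct Fs \<and> set Fs = facets \<Delta> \<and>
       (\<forall>i. 1 \<le> i \<and> i < length Fs \<longrightarrow>
          pure_of_dim
            (generated_complex (set (take i Fs)) \<inter> generated_complex {Fs ! i})
            (face_dim (Fs ! i) - 1)))"

definition squarefree_monomial :: "'x::finite set \<Rightarrow> ('x, 'k::field) mpoly"
  where "squarefree_monomial F = Poly_Mapping.single (\<Sum>i\<in>F. Poly_Mapping.single i 1) 1"

definition squarefree_monomial_ideal :: "('x::finite, 'k::field) mpoly set \<Rightarrow> bool"
  where "squarefree_monomial_ideal J \<longleftrightarrow>
    (\<exists>\<F>. J = genideal mpoly_ring (squarefree_monomial ` \<F>))"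

definition stanley_reisner_complex :: "('x::finite, 'k::field) mpoly set \<Rightarrow> 'x set set"
  where "stanley_reisner_complex J = {F. squarefree_monomial F \<notin> J}"


section \<open>Lattice paths\<close>

definition increasing_lattice_path ::
    "(nat ^ 'p::finite) list \<Rightarrow> nat ^ 'p \<Rightarrow> nat ^ 'p \<Rightarrow> bool"
  where "increasing_lattice_path as a b \<longleftrightarrow> as \<noteq> [] \<and> hd as = a \<and> last as = b \<and>
    (\<forall>j. Suc j < length as \<longrightarrow> (\<exists>i. as ! Suc j = as ! j + axis i 1))"

end

theory Submission
  imports Defs
begin

text \<open>
  Let \<open>D\<close> be the Stanley--Reisner complex and write \<open>g\<^sub>j(G)\<close> for the number of vertices of degree
  \<open>\<^bold>e\<^sub>j\<close> in a face \<open>G\<close>. Sorting the monomials outside \<open>J\<close> by their support, the Hilbert function is, for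
  positive \<open>v\<close>, a sum over the faces of products of binomials \<open>v\<^sub>j - 1 choose g\<^sub>j(G) - 1\<close>, which Vandermonde's
  identity expands in the basis \<open>v\<^sub>j + n\<^sub>j choose n\<^sub>j\<close> with \<open>n\<^sub>j < g\<^sub>j(G)\<close>. So a point \<open>n\<close> of the support
  satisfies \<open>n\<^sub>j < g\<^sub>j(G)\<close> for some face \<open>G\<close>, and \<open>G\<close> lies in a facet \<open>F\<close>. At \<open>a\<^sub>j = g\<^sub>j(F) - 1\<close> only faces
  with the same \<open>g\<^sub>j\<close> as \<open>F\<close> contribute, each with coefficient 1, because \<open>D\<close> is pure.

  It remains to see that \<open>dim Z = card F - p\<close>. Faces between a transversal of the blocks and \<open>F\<close> give a
  chain of monomial primes of this length. Conversely, given a chain of primes of length \<open>m\<close> below a relevant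
  homogeneous prime \<open>P\<close>, choose a variable outside \<open>P\<close> in each of the \<open>p\<close> degrees and an element
  \<open>f\<^sub>i\<close> in each difference of consecutive primes. The products of powers of these \<open>m + p\<close> elements with
  exponents at most \<open>K\<close> are linearly independent modulo \<open>J\<close>, whereas the monomials outside \<open>J\<close> with
  exponents \<open>O(K)\<close> number only \<open>O(K ^ card F)\<close>; hence \<open>m + p \<le> card F\<close>.
\<close>

no_notation fps_nth (infixl \<open>$\<close> 75)

section \<open>Polynomial maps\<close>

lemma mpoly_induct [case_names single add]:
  fixes f :: "'a \<Rightarrow>\<^sub>0 'b::comm_monoid_add"
  assumes single: "\<And>m c. P (Poly_Mapping.single m c)"
    and add: "\<And>f g. P f \<Longrightarrow> P g \<Longrightarrow> P (f + g)"
  shows "P f"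
proof (induction f rule: Poly_Mapping.update_induct)
  case const
  show ?case using single[of undefined 0] by simp
next
  case (update f a b)
  have "Poly_Mapping.update a b f = f + Poly_Mapping.single a b"
    using update(1)
    by (intro poly_mapping_eqI) (auto simp: lookup_update lookup_add lookup_single in_keys_iff when_def)
  then show ?case using update add single by simp
qed

text \<open>For \<open>h\<close> a ring homomorphism and \<open>\<phi>\<close> multiplicative this
  is the substitution homomorphism. It covers evaluation at a point and also the map to univariate
  polynomials that shows the monomial ideals to be prime.\<close>

definition mpoly_hom ::
    "('k::comm_ring_1 \<Rightarrow> 'a::comm_ring_1) \<Rightarrow> (('x \<Rightarrow>\<^sub>0 nat) \<Rightarrow> 'a) \<Rightarrow> ('x, 'k) mpoly \<Rightarrow> 'a"
  where "mpoly_hom h \<phi> f = (\<Sum>m\<in>Poly_Mapping.keys f. h (Poly_Mapping.lookup f m) * \<phi> m)"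

lemma mpoly_hom_single:
  assumes "h 0 = 0"
  shows "mpoly_hom h \<phi> (Poly_Mapping.single m c) = h c * \<phi> m"
  using assms by (auto simp: mpoly_hom_def)

lemma mpoly_hom_add:
  assumes "\<And>a b. h (a + b) = h a + h b"
  shows "mpoly_hom h \<phi> (f + g) = mpoly_hom h \<phi> f + mpoly_hom h \<phi> g"
proof -
  have "h 0 = 0" using assms[of 0 0] by simp
  then show ?thesis
    unfolding mpoly_hom_def
    by (intro setsum_keys_plus_distrib) (auto simp: assms algebra_simps)
qed

lemma mpoly_hom_mult:
  assumes add: "\<And>a b. h (a + b) = h a + h b"
    and mult: "\<And>a b. h (a * b) = h a * h b"
    and \<phi>: "\<And>m n. \<phi> (m + n) = \<phi> m * \<phi> n"
  shows "mpoly_hom h \<phi> (f * g) = mpoly_hom h \<phi> f * mpoly_hom h \<phi> g"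
proof -
  have 0: "h 0 = 0" using add[of 0 0] by simp
  show ?thesis
  proof (induction f rule: mpoly_induct)
    case (single m c)
    show ?case
      by (induction g rule: mpoly_induct)
        (simp_all add: mult_single mpoly_hom_single mpoly_hom_add add mult \<phi> 0 algebra_simps)
  qed (simp add: mpoly_hom_add add distrib_right)
qed

lemma eval_mpoly_conv_hom:
  "eval_mpoly P t = mpoly_hom (\<lambda>c. c) (\<lambda>m. \<Prod>i\<in>UNIV. t $ i ^ Poly_Mapping.lookup m i) P"
  by (simp add: eval_mpoly_def mpoly_hom_def)

lemma eval_mpoly_single:
  "eval_mpoly (Poly_Mapping.single m c) t = c * (\<Prod>i\<in>UNIV. t $ i ^ Poly_Mapping.lookup m i)"
  by (simp add: eval_mpoly_conv_hom mpoly_hom_single)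

lemma eval_mpoly_add: "eval_mpoly (P + Q) t = eval_mpoly P t + eval_mpoly Q t"
  by (simp add: eval_mpoly_conv_hom mpoly_hom_add)

lemma eval_mpoly_mult: "eval_mpoly (P * Q) t = eval_mpoly P t * eval_mpoly Q t"
  unfolding eval_mpoly_conv_hom
  by (rule mpoly_hom_mult) (auto simp: lookup_add power_add prod.distrib)

lemma eval_mpoly_diff: "eval_mpoly (P - Q) t = eval_mpoly P t - eval_mpoly Q t"
  using eval_mpoly_add[of "P - Q" Q t] by simp

text \<open>Kronecker substitution: if all exponents stay below \<open>N\<close>, they can be read
  as digits in base \<open>N\<close>. Replacing each variable by the power \<open>w i\<close> of one
  indeterminate then keeps the monomials of \<open>M\<close> apart.\<close>

lemma exists_injective_weights:
  fixes M :: "('x::finite \<Rightarrow>\<^sub>0 nat) set"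
  assumes "finite M"
  obtains w :: "'x \<Rightarrow> nat"
  where "\<And>i. 0 < w i" and "inj_on (\<lambda>m. \<Sum>i\<in>UNIV. Poly_Mapping.lookup m i * w i) M"
proof -
  define N where "N = Suc (Max ((\<lambda>(m, i). Poly_Mapping.lookup m i) ` (M \<times> UNIV)))"
  have N: "Poly_Mapping.lookup m i < N" if "m \<in> M" for m i
  proof -
    have "Poly_Mapping.lookup m i \<le> Max ((\<lambda>(m, i). Poly_Mapping.lookup m i) ` (M \<times> UNIV))"
      using assms that by (intro Max_ge) auto
    then show ?thesis by (simp add: N_def)
  qed
  have "\<exists>w. (\<forall>i. 0 < w i) \<and> (\<forall>m\<in>M. \<forall>m'\<in>M.
      (\<Sum>i\<in>A. Poly_Mapping.lookup m i * w i) = (\<Sum>i\<in>A. Poly_Mapping.lookup m' i * w i) \<longrightarrow>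
      (\<forall>i\<in>A. Poly_Mapping.lookup m i = Poly_Mapping.lookup m' i))" for A :: "'x set"
  proof (induction A rule: finite_induct[OF finite])
    case 1
    show ?case by (auto intro!: exI[of _ "\<lambda>_. 1"])
  next
    case (2 a A)
    then obtain w where w: "\<And>i. 0 < w i"
      and inj: "\<And>m m'. m \<in> M \<Longrightarrow> m' \<in> M \<Longrightarrow>
        (\<Sum>i\<in>A. Poly_Mapping.lookup m i * w i) = (\<Sum>i\<in>A. Poly_Mapping.lookup m' i * w i) \<Longrightarrow>
        \<forall>i\<in>A. Poly_Mapping.lookup m i = Poly_Mapping.lookup m' i" by metis
    \<comment> \<open>The exponent of \<open>a\<close> becomes the lowest digit, and the weights
      found so far move up by one digit.\<close>
    define w' where "w' i = (if i = a then 1 else N * w i)" for i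
    have N0: "0 < N" by (simp add: N_def)
    have sum: "(\<Sum>i\<in>insert a A. Poly_Mapping.lookup m i * w' i)
        = Poly_Mapping.lookup m a + N * (\<Sum>i\<in>A. Poly_Mapping.lookup m i * w i)" for m
    proof -
      have "(\<Sum>i\<in>A. Poly_Mapping.lookup m i * w' i) = (\<Sum>i\<in>A. N * (Poly_Mapping.lookup m i * w i))"
        using 2 by (intro sum.cong) (auto simp: w'_def)
      then show ?thesis using 2 by (simp add: w'_def sum_distrib_left)
    qed
    have "\<forall>i\<in>insert a A. Poly_Mapping.lookup m i = Poly_Mapping.lookup m' i"
      if m: "m \<in> M" "m' \<in> M"
        and eq: "(\<Sum>i\<in>insert a A. Poly_Mapping.lookup m i * w' i)
          = (\<Sum>i\<in>insert a A. Poly_Mapping.lookup m' i * w' i)" for m m'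
    proof -
      let ?s = "\<lambda>m. \<Sum>i\<in>A. Poly_Mapping.lookup m i * w i"
      have e: "Poly_Mapping.lookup m a + N * ?s m = Poly_Mapping.lookup m' a + N * ?s m'"
        using eq unfolding sum .
      from arg_cong[OF e, of "\<lambda>x. x mod N"] have a: "Poly_Mapping.lookup m a = Poly_Mapping.lookup m' a"
        using N m by simp
      with e N0 have "?s m = ?s m'" by simp
      with inj m a show ?thesis by blast
    qed
    moreover have "\<forall>i. 0 < w' i" using w N0 by (simp add: w'_def)
    ultimately show ?case by blast
  qed
  from this[of UNIV] obtain w :: "'x \<Rightarrow> nat" where "\<forall>i. 0 < w i" "\<forall>m\<in>M. \<forall>m'\<in>M.
      (\<Sum>i\<in>UNIV. Poly_Mapping.lookup m i * w i) = (\<Sum>i\<in>UNIV. Poly_Mapping.lookup m' i * w i) \<longrightarrow>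
      (\<forall>i. Poly_Mapping.lookup m i = Poly_Mapping.lookup m' i)" by auto
  then show thesis using that[of w] by (auto intro!: inj_onI poly_mapping_eqI)
qed

text \<open>On the curve \<open>t $ i = x ^ w i\<close>, with weights separating the monomials of
  \<open>P\<close>, the polynomial becomes a univariate \<open>q\<close> with the same coefficients.
  Positive weights push the curve above \<open>v0\<close>, so \<open>q\<close> has infinitely many
  roots. This makes the Hilbert polynomial unique.\<close>

lemma mpoly_eq_0_if_eventually_0:
  fixes P :: "('p::finite, rat) mpoly" and v0 :: "nat ^ 'p"
  assumes zero: "\<And>v. v0 \<le> v \<Longrightarrow> eval_mpoly P (\<chi> i. of_nat (v $ i)) = 0"
  shows "P = 0"
proof -
  obtain w :: "'p \<Rightarrow> nat" where w: "\<And>i. 0 < w i"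
    and inj: "inj_on (\<lambda>m. \<Sum>i\<in>UNIV. Poly_Mapping.lookup m i * w i) (Poly_Mapping.keys P)"
    using exists_injective_weights[OF finite_keys] by blast
  let ?W = "\<lambda>m. \<Sum>i\<in>UNIV. Poly_Mapping.lookup m i * w i"
  define q where "q = (\<Sum>m\<in>Poly_Mapping.keys P. Polynomial.monom (Poly_Mapping.lookup P m) (?W m))"
  have poly_q: "poly q x = eval_mpoly P (\<chi> i. x ^ w i)" for x
    by (simp add: q_def eval_mpoly_def poly_sum poly_monom power_sum mult.commute flip: power_mult)
  have root: "poly q (of_nat x) = 0" if x: "Suc (\<Sum>i\<in>UNIV. v0 $ i) \<le> x" for x
  proof -
    have "v0 $ i \<le> x ^ w i" for i
    proof -
      have "v0 $ i \<le> (\<Sum>i\<in>UNIV. v0 $ i)" by (rule member_le_sum) auto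
      also have "\<dots> \<le> x ^ 1" using x by simp
      also have "\<dots> \<le> x ^ w i" using w[of i] x by (intro power_increasing) auto
      finally show ?thesis .
    qed
    then have "v0 \<le> (\<chi> i. x ^ w i)" by (simp add: less_eq_vec_def)
    from zero[OF this] show ?thesis unfolding poly_q by simp
  qed
  have "q = 0"
  proof (rule ccontr)
    assume "q \<noteq> 0"
    then have "finite {x. poly q x = 0}" by (rule poly_roots_finite)
    moreover have "of_nat ` {Suc (\<Sum>i\<in>UNIV. v0 $ i)..} \<subseteq> {x. poly q x = 0}" using root by auto
    moreover have "infinite (of_nat ` {Suc (\<Sum>i\<in>UNIV. v0 $ i)..} :: rat set)"
      by (subst finite_image_iff) (auto simp: infinite_Ici inj_on_def)
    ultimately show False using finite_subset by blast
  qed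
  have "Poly_Mapping.lookup P m = 0" for m
  proof (cases "m \<in> Poly_Mapping.keys P")
    case True
    have "Polynomial.coeff q (?W m) = (\<Sum>m'\<in>Poly_Mapping.keys P. if m' = m then Poly_Mapping.lookup P m' else 0)"
      unfolding q_def Polynomial.coeff_sum using inj True
      by (intro sum.cong) (auto dest: inj_onD)
    then show ?thesis using True \<open>q = 0\<close> by simp
  qed (simp add: in_keys_iff)
  then show ?thesis by (intro poly_mapping_eqI) simp
qed

section \<open>Functions given by polynomials\<close>

definition polynomial_map :: "('k::comm_ring_1 ^ 'p::finite \<Rightarrow> 'k) \<Rightarrow> bool"
  where "polynomial_map f \<longleftrightarrow> (\<exists>P. \<forall>t. eval_mpoly P t = f t)"

lemma polynomial_map_const: "polynomial_map (\<lambda>_. c)"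
  unfolding polynomial_map_def by (rule exI[of _ "Poly_Mapping.single 0 c"]) (simp add: eval_mpoly_single)

lemma polynomial_map_coord: "polynomial_map (\<lambda>t. t $ i)"
  unfolding polynomial_map_def
proof (intro exI allI)
  fix t :: "'a ^ 'b"
  have "(\<Prod>j\<in>UNIV. t $ j ^ Poly_Mapping.lookup (Poly_Mapping.single i 1) j)
      = (\<Prod>j\<in>UNIV. if j = i then t $ j else 1)"
    by (intro prod.cong) (auto simp: lookup_single when_def)
  then show "eval_mpoly (Poly_Mapping.single (Poly_Mapping.single i 1) 1) t = t $ i"
    by (simp add: eval_mpoly_single)
qed

lemma polynomial_map_add:
  "polynomial_map f \<Longrightarrow> polynomial_map g \<Longrightarrow> polynomial_map (\<lambda>t. f t + g t)"
  unfolding polynomial_map_def by (metis eval_mpoly_add)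

lemma polynomial_map_mult:
  "polynomial_map f \<Longrightarrow> polynomial_map g \<Longrightarrow> polynomial_map (\<lambda>t. f t * g t)"
  unfolding polynomial_map_def by (metis eval_mpoly_mult)

lemma polynomial_map_sum:
  assumes "\<And>i. i \<in> A \<Longrightarrow> polynomial_map (f i)"
  shows "polynomial_map (\<lambda>t. \<Sum>i\<in>A. f i t)"
  using assms
  by (induction A rule: infinite_finite_induct) (auto intro: polynomial_map_const polynomial_map_add)

lemma polynomial_map_prod:
  assumes "\<And>i. i \<in> A \<Longrightarrow> polynomial_map (f i)"
  shows "polynomial_map (\<lambda>t. \<Prod>i\<in>A. f i t)"
  using assms
  by (induction A rule: infinite_finite_induct) (auto intro: polynomial_map_const polynomial_map_mult)

lemma polynomial_map_gbinomial:
  fixes f :: "rat ^ 'p::finite \<Rightarrow> rat"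
  assumes "polynomial_map f"
  shows "polynomial_map (\<lambda>t. f t gchoose n)"
proof -
  have "polynomial_map (\<lambda>t. (1 / fact n) * (\<Prod>i=0..<n. f t + (- of_nat i)))"
    by (intro polynomial_map_mult polynomial_map_prod polynomial_map_add polynomial_map_const assms)
  then show ?thesis by (simp add: gbinomial_prod_rev)
qed

section \<open>Binomial expansions\<close>

text \<open>The expansion that occurs inside \<open>binomial_coeffs\<close>, here as a function of
  the coefficient family, so that uniqueness can be stated as injectivity.\<close>

definition binomial_comb :: "(nat ^ 'p::finite \<Rightarrow> rat) \<Rightarrow> rat ^ 'p \<Rightarrow> rat"
  where "binomial_comb c t =
    (\<Sum>n | c n \<noteq> 0. c n * (\<Prod>i\<in>UNIV. (t $ i + of_nat (n $ i)) gchoose (n $ i)))"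

lemma binomial_comb_superset:
  assumes "finite A" "\<And>n. c n \<noteq> 0 \<Longrightarrow> n \<in> A"
  shows "binomial_comb c t = (\<Sum>n\<in>A. c n * (\<Prod>i\<in>UNIV. (t $ i + of_nat (n $ i)) gchoose (n $ i)))"
  unfolding binomial_comb_def using assms by (intro sum.mono_neutral_left) auto

text \<open>The basis is triangular with respect to evaluation at the points \<open>-1 - k\<close>.
  At a suitable \<open>k\<close> every term of the difference vanishes except the one with index
  \<open>k\<close>, whose basis polynomial takes the value 1 or -1.\<close>

lemma binomial_comb_inj:
  assumes "finite {n. c n \<noteq> 0}" "finite {n. c' n \<noteq> 0}"
    and eq: "\<And>t. binomial_comb c t = binomial_comb c' t"
  shows "c = c'"
proof (rule ext, rule ccontr)
  fix n0
  assume n0: "c n0 \<noteq> c' n0"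
  define A where "A = {n. c n \<noteq> 0} \<union> {n. c' n \<noteq> 0}"
  have A: "finite A" using assms by (simp add: A_def)
  define B where "B = {n\<in>A. c n \<noteq> c' n}"
  have "n0 \<in> B" using n0 by (auto simp: B_def A_def)
  \<comment> \<open>Among the indices where the families differ, \<open>k\<close> has the least
    total. Another such \<open>n\<close> with \<open>n \<le> k\<close> would have a smaller total,
    so it must exceed \<open>k\<close> in some coordinate.\<close>
  then obtain k where k: "k \<in> B"
    and min: "\<And>n. n \<in> B \<Longrightarrow> (\<Sum>i\<in>UNIV. k $ i) \<le> (\<Sum>i\<in>UNIV. n $ i)"
    using ex_has_least_nat[of "\<lambda>n. n \<in> B" n0 "\<lambda>n. \<Sum>i\<in>UNIV. n $ i"] by auto
  \<comment> \<open>at \<open>t = -1 - k\<close> the \<open>n\<close>-th basis polynomial vanishes unless \<open>n \<le> k\<close>\<close>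
  define t :: "rat ^ 'a" where "t = (\<chi> i. - 1 - of_nat (k $ i))"
  have neg: "(t $ i + of_nat (n $ i)) gchoose (n $ i) = (- 1) ^ (n $ i) * of_nat ((k $ i) choose (n $ i))"
    for n :: "nat ^ 'a" and i
    by (subst gbinomial_negated_upper) (simp add: t_def binomial_gbinomial)
  have "0 = binomial_comb c t - binomial_comb c' t" using eq by simp
  also have "\<dots> = (\<Sum>n\<in>A. (c n - c' n) * (\<Prod>i\<in>UNIV. (t $ i + of_nat (n $ i)) gchoose (n $ i)))"
    by (subst (1 2) binomial_comb_superset[OF A])
      (auto simp: A_def sum_subtractf algebra_simps)
  also have "\<dots> = (\<Sum>n\<in>A. if n = k then (c k - c' k) * (\<Prod>i\<in>UNIV. (- 1) ^ (k $ i)) else 0)"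
  proof (intro sum.cong refl)
    fix n assume n: "n \<in> A"
    show "(c n - c' n) * (\<Prod>i\<in>UNIV. (t $ i + of_nat (n $ i)) gchoose (n $ i))
        = (if n = k then (c k - c' k) * (\<Prod>i\<in>UNIV. (- 1) ^ (k $ i)) else 0)"
    proof (cases "n = k")
      case False
      show ?thesis
      proof (cases "c n = c' n")
        case ne: False
        have "\<exists>i. k $ i < n $ i"
        proof (rule ccontr)
          assume "\<not> (\<exists>i. k $ i < n $ i)"
          then have le: "n $ i \<le> k $ i" for i by (simp add: not_less)
          have "n $ j = k $ j" for j
          proof (rule ccontr)
            assume "n $ j \<noteq> k $ j"
            then have "(\<Sum>i\<in>UNIV. n $ i) < (\<Sum>i\<in>UNIV. k $ i)"
              using le by (intro sum_strict_mono_ex1) (auto intro!: bexI[of _ j] simp: order.strict_iff_order)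
            then show False using min[of n] n ne by (simp add: B_def)
          qed
          then show False using False by (simp add: vec_eq_iff)
        qed
        then obtain i where "k $ i < n $ i" by blast
        then have "(\<Prod>i\<in>UNIV. (t $ i + of_nat (n $ i)) gchoose (n $ i)) = 0"
          unfolding neg by (intro prod_zero) auto
        then show ?thesis using False by simp
      qed (simp add: False)
    qed (simp add: neg)
  qed
  also have "\<dots> = (c k - c' k) * (\<Prod>i\<in>UNIV. (- 1) ^ (k $ i))"
    using k A by (simp add: B_def)
  finally show False using k by (auto simp: B_def)
qed

lemma binomial_coeffs_eqI:
  assumes "finite {n. c n \<noteq> 0}" "\<And>t. eval_mpoly P t = binomial_comb c t"
  shows "binomial_coeffs P = c"
  unfolding binomial_coeffs_def binomial_comb_def[symmetric]
proof (rule the_equality)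
  fix c' assume "finite {n. c' n \<noteq> 0} \<and> (\<forall>t. eval_mpoly P t = binomial_comb c' t)"
  then show "c' = c" using assms by (intro binomial_comb_inj) auto
qed (use assms in auto)

text \<open>Two polynomials agreeing with the Hilbert function far out have a difference that
  vanishes far out; this uniqueness resolves the definite description.\<close>

lemma hilbert_polynomial_eqI:
  fixes P :: "('p::finite, rat) mpoly"
  assumes "\<And>v. v0 \<le> v \<Longrightarrow> eval_mpoly P (\<chi> i. of_nat (v $ i)) = of_nat (hilbert_function R K gr v)"
  shows "hilbert_polynomial R K gr = P"
  unfolding hilbert_polynomial_def
proof (rule the_equality)
  fix Q :: "('p, rat) mpoly"
  assume "\<exists>v0. \<forall>v\<ge>v0. eval_mpoly Q (\<chi> i. of_nat (v $ i)) = of_nat (hilbert_function R K gr v)"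
  then obtain v1 where v1:
    "\<And>v. v1 \<le> v \<Longrightarrow> eval_mpoly Q (\<chi> i. of_nat (v $ i)) = of_nat (hilbert_function R K gr v)" by blast
  have "Q - P = 0"
  \<comment> \<open>The coordinatewise sum lies above both thresholds.\<close>
  proof (rule mpoly_eq_0_if_eventually_0[of "\<chi> i. v0 $ i + v1 $ i"])
    fix v assume "(\<chi> i. v0 $ i + v1 $ i) \<le> v"
    then have "v0 \<le> v" "v1 \<le> v"
      unfolding less_eq_vec_def by (auto intro: order.trans[rotated])
    then show "eval_mpoly (Q - P) (\<chi> i. of_nat (v $ i)) = 0"
      using assms v1 by (simp add: eval_mpoly_diff)
  qed
  then show "Q = P" by simp
qed (use assms in blast)

lemma multidegree_eqI:
  assumes fin: "finite {n. c n \<noteq> 0}"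
    and hilb: "\<And>v. v0 \<le> v \<Longrightarrow>
      of_nat (hilbert_function (quot_ring J) (quot_scalars J) (quot_piece d J) v)
        = binomial_comb c (\<chi> i. of_nat (v $ i))"
  shows "multidegree d J = c"
proof -
  have "polynomial_map (binomial_comb c)"
    unfolding binomial_comb_def
    by (intro polynomial_map_sum polynomial_map_mult polynomial_map_prod polynomial_map_gbinomial
        polynomial_map_add polynomial_map_const polynomial_map_coord)
  then obtain P where P: "\<And>t. eval_mpoly P t = binomial_comb c t" by (auto simp: polynomial_map_def)
  then have "hilbert_polynomial (quot_ring J) (quot_scalars J) (quot_piece d J) = P"
    by (intro hilbert_polynomial_eqI[of v0]) (simp add: hilb)
  then show ?thesis unfolding multidegree_def using P fin by (simp add: binomial_coeffs_eqI)
qed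

section \<open>Counting monomials of a given degree\<close>

text \<open>The number of ways to write \<open>v\<close> as an ordered sum of \<open>g\<close>
  positive integers. The case \<open>v = 0\<close> is kept apart because \<open>v - 1\<close> is
  truncated there.\<close>

fun compositions :: "nat \<Rightarrow> nat \<Rightarrow> nat"
  where
    "compositions v 0 = (if v = 0 then 1 else 0)"
  | "compositions v (Suc g) = (if v = 0 then 0 else (v - 1) choose g)"

text \<open>Split off one part: \<open>u\<close> is the sum of the other \<open>g\<close> parts, and
  \<open>u < v\<close> says that the part removed is positive.\<close>

lemma compositions_Suc_eq_sum: "compositions v (Suc g) = (\<Sum>u<v. compositions u g)"
proof (induction v)
  case (Suc v)
  have "compositions (Suc v) (Suc g) = compositions v (Suc g) + compositions v g"
    by (cases v; cases g) auto
  then show ?case using Suc by simp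
qed simp

text \<open>For \<open>g \<le> n\<close> the truncated exponent is harmless, since the binomial coefficient vanishes.\<close>

definition comp_coeff :: "nat \<Rightarrow> nat \<Rightarrow> rat"
  where "comp_coeff g n = (- 1) ^ (g - 1 - n) * of_nat (g choose Suc n)"

text \<open>Vandermonde's identity between two upper negations. Positivity of \<open>v\<close>
  matters for \<open>g = 0\<close>, where both sides are 0, and for \<open>v - 1\<close>. Any bound
  \<open>M\<close> beyond \<open>g\<close> serves, since the coefficients vanish from
  \<open>n = g\<close> on; this allows one common bound for all faces.\<close>

lemma compositions_eq_gbinomial_sum:
  assumes "0 < v" "g \<le> M"
  shows "of_nat (compositions v g) = (\<Sum>n<M. comp_coeff g n * ((of_nat v + of_nat n) gchoose n))"
proof (cases g)
  case 0
  then show ?thesis using assms by (simp add: comp_coeff_def)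
next
  case (Suc N)
  have "of_nat (compositions v g) = ((of_nat v - 1) gchoose N :: rat)"
    using Suc assms by (simp add: binomial_gbinomial of_nat_diff)
  \<comment> \<open>After upper negation the top entry \<open>N - v\<close> is split into
    \<open>- v - 1\<close>, which a second negation turns into the basis polynomials, and
    \<open>Suc N = g\<close>, which gives the coefficients.\<close>
  also have "\<dots> = (- 1) ^ N * ((- of_nat v - 1) + of_nat (Suc N) gchoose N)"
    by (subst gbinomial_negated_upper) (simp add: algebra_simps)
  also have "\<dots> = (\<Sum>n=0..N. (- 1) ^ N * ((- of_nat v - 1 gchoose n) * (of_nat (Suc N) gchoose (N - n))))"
    by (simp only: gbinomial_Vandermonde[symmetric] sum_distrib_left)
  also have "\<dots> = (\<Sum>n=0..N. comp_coeff g n * ((of_nat v + of_nat n) gchoose n))"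
  proof (intro sum.cong refl)
    fix n assume n: "n \<in> {0..N}"
    have 1: "(- of_nat v - 1 gchoose n :: rat) = (- 1) ^ n * ((of_nat v + of_nat n) gchoose n)"
      by (subst gbinomial_negated_upper) (simp add: algebra_simps)
    have 2: "(of_nat (Suc N) gchoose (N - n) :: rat) = of_nat (g choose Suc n)"
      using n Suc by (subst binomial_gbinomial[symmetric], subst binomial_symmetric) (auto simp: Suc_diff_le)
    have 3: "(- 1) ^ N * (- 1) ^ n = ((- 1) ^ (g - 1 - n) :: rat)"
      using n Suc by (auto simp: minus_one_power_iff)
    show "(- 1) ^ N * ((- of_nat v - 1 gchoose n) * (of_nat (Suc N) gchoose (N - n)))
        = comp_coeff g n * ((of_nat v + of_nat n) gchoose n)"
      unfolding 1 2 comp_coeff_def 3[symmetric] by (simp add: mult_ac)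
  qed
  also have "\<dots> = (\<Sum>n<M. comp_coeff g n * ((of_nat v + of_nat n) gchoose n))"
    using Suc assms by (intro sum.mono_neutral_left) (auto simp: comp_coeff_def simp del: binomial_Suc_Suc)
  finally show ?thesis .
qed

lemma finite_vec_box: "finite {n :: nat ^ 'p::finite. \<forall>j. n $ j < M}"
proof (rule finite_subset)
  show "{n :: nat ^ 'p. \<forall>j. n $ j < M} \<subseteq> vec_lambda ` (PiE UNIV (\<lambda>_. {..<M}))"
  proof
    fix n :: "nat ^ 'p" assume "n \<in> {n. \<forall>j. n $ j < M}"
    then have "n = vec_lambda (vec_nth n)" "vec_nth n \<in> PiE UNIV (\<lambda>_. {..<M})" by auto
    then show "n \<in> vec_lambda ` (PiE UNIV (\<lambda>_. {..<M}))" by blast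
  qed
qed (intro finite_imageI finite_PiE; simp)

lemma prod_sum_vec:
  fixes h :: "'p::finite \<Rightarrow> nat \<Rightarrow> 'a::comm_semiring_1"
  shows "(\<Prod>j\<in>UNIV. \<Sum>n<M. h j n) = (\<Sum>n | \<forall>j. n $ j < M. \<Prod>j\<in>UNIV. h j (n $ j))"
proof -
  have "(\<Prod>j\<in>UNIV. \<Sum>n<M. h j n) = (\<Sum>f\<in>PiE UNIV (\<lambda>_. {..<M}). \<Prod>j\<in>UNIV. h j (f j))"
    by (rule prod_sum_PiE) auto
  also have "\<dots> = (\<Sum>n | \<forall>j. n $ j < M. \<Prod>j\<in>UNIV. h j (n $ j))"
    by (rule sum.reindex_bij_witness[of _ vec_nth vec_lambda]) auto
  finally show ?thesis .
qed

section \<open>Blocks of variables of equal degree, and monomials of given support and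
  degree\<close>

locale standard_graded =
  fixes d :: "'x::finite \<Rightarrow> nat ^ 'p::finite" and b :: "'x \<Rightarrow> 'p"
  assumes degree_variable: "d i = axis (b i) 1"
begin

abbreviation deg :: "('x \<Rightarrow>\<^sub>0 nat) \<Rightarrow> nat ^ 'p"
  where "deg \<equiv> monomial_degree d"

definition block_card :: "'x set \<Rightarrow> 'p \<Rightarrow> nat"
  where "block_card G j = card {i\<in>G. b i = j}"

lemma deg_nth: "deg m $ j = (\<Sum>i | b i = j. Poly_Mapping.lookup m i)"
proof -
  have "deg m $ j = (\<Sum>i\<in>UNIV. if b i = j then Poly_Mapping.lookup m i else 0)"
    by (auto simp: monomial_degree_def degree_variable axis_def intro!: sum.cong)
  then show ?thesis by (simp add: sum.If_cases Int_def)
qed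

lemma deg_add: "deg (m + n) = deg m + deg n"
  by (simp add: vec_eq_iff deg_nth lookup_add sum.distrib)

lemma deg_single_nth: "deg (Poly_Mapping.single a k) $ j = (if b a = j then k else 0)"
  by (simp add: deg_nth lookup_single when_def)

lemma deg_zero [simp]: "deg 0 = 0"
  by (simp add: vec_eq_iff deg_nth)

lemma lookup_le_deg: "Poly_Mapping.lookup m i \<le> deg m $ b i"
  unfolding deg_nth by (rule member_le_sum) auto

lemma sum_block_card: "(\<Sum>j\<in>UNIV. block_card G j) = card G"
proof -
  have "(\<Sum>j\<in>UNIV. block_card G j) = card (\<Union>j. {i\<in>G. b i = j})"
    unfolding block_card_def by (rule card_UN_disjoint[symmetric]) auto
  also have "(\<Union>j. {i\<in>G. b i = j}) = G" by auto
  finally show ?thesis .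
qed

lemma block_card_insert:
  assumes "a \<notin> G"
  shows "block_card (insert a G) j = (if b a = j then Suc (block_card G j) else block_card G j)"
proof (cases "b a = j")
  case True
  then have "{i\<in>insert a G. b i = j} = insert a {i\<in>G. b i = j}" by auto
  then show ?thesis using assms True by (simp add: block_card_def)
next
  case False
  then have "{i\<in>insert a G. b i = j} = {i\<in>G. b i = j}" by auto
  then show ?thesis using False by (simp add: block_card_def)
qed

lemma block_card_mono: "G \<subseteq> F \<Longrightarrow> block_card G j \<le> block_card F j"
  unfolding block_card_def by (rule card_mono) auto

lemma block_card_le: "block_card G j \<le> CARD('x)"
  unfolding block_card_def by (rule card_mono) auto

text \<open>In each block the degree is distributed over the variables of \<open>G\<close> in that
  block with positive exponents, independently of the other blocks. Finiteness is carried along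
  because the count of the disjoint union in the induction step needs it.\<close>

lemma card_monomials_support:
  "finite {m. Poly_Mapping.keys m = G \<and> deg m = v} \<and>
   card {m. Poly_Mapping.keys m = G \<and> deg m = v} = (\<Prod>j\<in>UNIV. compositions (v $ j) (block_card G j))"
proof (induction G arbitrary: v rule: finite_induct[OF finite])
  case 1
  have "{m. Poly_Mapping.keys m = {} \<and> deg m = v} = (if v = 0 then {0} else {})" by auto
  moreover have "(\<Prod>j\<in>UNIV. compositions (v $ j) (block_card {} j)) = (if v = 0 then 1 else 0)"
    by (auto simp: block_card_def vec_eq_iff)
  ultimately show ?case by simp
next
  case (2 a G)
  define S where "S G v = {m. Poly_Mapping.keys m = G \<and> deg m = v}" for G v
  \<comment> \<open>Here \<open>u\<close> is the degree left in the block of \<open>a\<close> once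
    that variable is removed, so \<open>a\<close> has exponent \<open>v $ b a - u\<close>, which is
    positive for \<open>u < v $ b a\<close>.\<close>
  define v' where "v' u = (\<chi> j. if j = b a then u else v $ j)" for u
  define T where "T u = (\<lambda>m. m + Poly_Mapping.single a (v $ b a - u)) ` S G (v' u)" for u
  have IH: "finite (S G w)" "card (S G w) = (\<Prod>j\<in>UNIV. compositions (w $ j) (block_card G j))" for w
    using 2(3)[of w] by (auto simp: S_def)
  have keysG: "Poly_Mapping.lookup m a = 0" if "m \<in> S G w" for m w
    using that 2(2) by (auto simp: S_def in_keys_iff)
  have eq: "S (insert a G) v = (\<Union>u\<in>{..<v $ b a}. T u)"
  proof (intro equalityI subsetI)
    fix m assume m: "m \<in> S (insert a G) v"
    define k where "k = Poly_Mapping.lookup m a"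
    have "a \<in> Poly_Mapping.keys m" using m by (simp add: S_def)
    then have k: "0 < k" by (simp add: k_def in_keys_iff)
    have k_le: "k \<le> v $ b a" using lookup_le_deg[of m a] m by (simp add: S_def k_def)
    define m' where "m' = m - Poly_Mapping.single a k"
    have m_eq: "m = m' + Poly_Mapping.single a k"
      by (intro poly_mapping_eqI) (auto simp: m'_def lookup_add lookup_minus lookup_single k_def when_def)
    have "Poly_Mapping.keys m' = G"
    proof -
      have "Poly_Mapping.lookup m' i = (if i = a then 0 else Poly_Mapping.lookup m i)" for i
        by (auto simp: m'_def lookup_minus lookup_single k_def when_def)
      moreover have "Poly_Mapping.lookup m i \<noteq> 0 \<longleftrightarrow> i \<in> insert a G" for i
        using m unfolding in_keys_iff[symmetric] by (simp add: S_def)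
      ultimately have "i \<in> Poly_Mapping.keys m' \<longleftrightarrow> i \<in> G" for i
        using 2(2) unfolding in_keys_iff by auto
      then show ?thesis by blast
    qed
    moreover have "deg m' = v' (v $ b a - k)"
    proof -
      have "v $ j = deg m' $ j + (if b a = j then k else 0)" for j
        using m unfolding S_def by (subst (asm) m_eq) (auto simp: deg_add deg_single_nth)
      then show ?thesis by (simp add: vec_eq_iff v'_def)
    qed
    ultimately have "m' \<in> S G (v' (v $ b a - k))" by (simp add: S_def)
    then have "m \<in> T (v $ b a - k)" using m_eq k_le by (auto simp: T_def)
    moreover have "v $ b a - k < v $ b a" using k k_le by simp
    ultimately show "m \<in> (\<Union>u\<in>{..<v $ b a}. T u)" by blast
  next
    fix m assume "m \<in> (\<Union>u\<in>{..<v $ b a}. T u)"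
    then obtain u m' where u: "u < v $ b a" and m': "m' \<in> S G (v' u)"
      and m_eq: "m = m' + Poly_Mapping.single a (v $ b a - u)" by (auto simp: T_def)
    have "i \<in> Poly_Mapping.keys m \<longleftrightarrow> i \<in> insert a G" for i
      using m' u keysG[OF m'] by (auto simp: S_def m_eq in_keys_iff lookup_add lookup_single when_def)
    then have "Poly_Mapping.keys m = insert a G" by blast
    moreover have "deg m = v"
      using m' u by (auto simp: S_def m_eq deg_add deg_single_nth v'_def vec_eq_iff)
    ultimately show "m \<in> S (insert a G) v" by (simp add: S_def)
  qed
  have finT: "finite (T u)" for u using IH by (simp add: T_def)
  have disj: "T u \<inter> T u' = {}" if "u < v $ b a" "u' < v $ b a" "u \<noteq> u'" for u u'
  proof (rule ccontr)
    assume "T u \<inter> T u' \<noteq> {}"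
    then obtain m m' where m: "m \<in> S G (v' u)" "m' \<in> S G (v' u')"
      "m + Poly_Mapping.single a (v $ b a - u) = m' + Poly_Mapping.single a (v $ b a - u')"
      unfolding T_def by blast
    from arg_cong[OF m(3), of "\<lambda>m. Poly_Mapping.lookup m a"] that show False
      by (simp add: lookup_add keysG[OF m(1)] keysG[OF m(2)])
  qed
  have cardT: "card (T u) = compositions u (block_card G (b a))
      * (\<Prod>j\<in>UNIV - {b a}. compositions (v $ j) (block_card G j))" for u
  proof -
    have "card (T u) = card (S G (v' u))" unfolding T_def by (rule card_image) (auto simp: inj_on_def)
    also have "\<dots> = compositions u (block_card G (b a))
      * (\<Prod>j\<in>UNIV - {b a}. compositions (v' u $ j) (block_card G j))"
      unfolding IH by (subst prod.remove[of _ "b a"]) (auto simp: v'_def)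
    also have "(\<Prod>j\<in>UNIV - {b a}. compositions (v' u $ j) (block_card G j))
        = (\<Prod>j\<in>UNIV - {b a}. compositions (v $ j) (block_card G j))"
      by (intro prod.cong) (auto simp: v'_def)
    finally show ?thesis .
  qed
  have "card (S (insert a G) v) = (\<Sum>u<v $ b a. card (T u))"
    unfolding eq using finT disj by (intro card_UN_disjoint) auto
  also have "\<dots> = compositions (v $ b a) (Suc (block_card G (b a)))
      * (\<Prod>j\<in>UNIV - {b a}. compositions (v $ j) (block_card G j))"
    unfolding cardT compositions_Suc_eq_sum sum_distrib_right ..
  also have "\<dots> = (\<Prod>j\<in>UNIV. compositions (v $ j) (block_card (insert a G) j))"
    by (subst (2) prod.remove[of _ "b a"]) (auto simp: block_card_insert[OF 2(2)] intro!: prod.cong)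
  finally have "card (S (insert a G) v) = (\<Prod>j\<in>UNIV. compositions (v $ j) (block_card (insert a G) j))" .
  moreover have "finite (S (insert a G) v)" unfolding eq using finT by auto
  ultimately show ?case unfolding S_def by blast
qed

text \<open>The coefficients obtained by expanding the count of every face in the binomial basis;
  they turn out to be the multidegrees.\<close>

definition face_coeff :: "'x set set \<Rightarrow> nat ^ 'p \<Rightarrow> rat"
  where "face_coeff D n = (\<Sum>G\<in>D. \<Prod>j\<in>UNIV. comp_coeff (block_card G j) (n $ j))"

lemma finite_monomials_degree: "finite {m. Poly_Mapping.keys m \<in> D \<and> deg m = v}"
proof -
  have "{m. Poly_Mapping.keys m \<in> D \<and> deg m = v}
      = (\<Union>G\<in>D. {m. Poly_Mapping.keys m = G \<and> deg m = v})" by auto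
  then show ?thesis using card_monomials_support by auto
qed

lemma card_monomials_degree:
  "card {m. Poly_Mapping.keys m \<in> D \<and> deg m = v}
    = (\<Sum>G\<in>D. \<Prod>j\<in>UNIV. compositions (v $ j) (block_card G j))"
proof -
  have "{m. Poly_Mapping.keys m \<in> D \<and> deg m = v}
      = (\<Union>G\<in>D. {m. Poly_Mapping.keys m = G \<and> deg m = v})" by auto
  also have "card \<dots> = (\<Sum>G\<in>D. card {m. Poly_Mapping.keys m = G \<and> deg m = v})"
    using card_monomials_support by (intro card_UN_disjoint) auto
  finally show ?thesis using card_monomials_support by simp
qed

text \<open>Some summand is nonzero, and its factors contain \<open>g choose Suc n\<close>, which
  vanishes as soon as \<open>g \<le> n\<close>. This yields the face lying above a point of the
  support.\<close>

lemma face_coeff_nonzeroE: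
  assumes "face_coeff D n \<noteq> 0"
  obtains G where "G \<in> D" "\<And>j. n $ j < block_card G j"
proof -
  obtain G where G: "G \<in> D" "(\<Prod>j\<in>UNIV. comp_coeff (block_card G j) (n $ j)) \<noteq> 0"
    using assms unfolding face_coeff_def by (meson sum.not_neutral_contains_not_neutral)
  have "n $ j < block_card G j" for j
  proof (rule ccontr)
    assume "\<not> n $ j < block_card G j"
    then have "comp_coeff (block_card G j) (n $ j) = 0" by (simp add: comp_coeff_def)
    then show False using G(2) by simp
  qed
  then show thesis using that G by blast
qed

lemma finite_face_coeff_support: "finite {n. face_coeff D n \<noteq> 0}"
proof (rule finite_subset)
  show "{n. face_coeff D n \<noteq> 0} \<subseteq> {n. \<forall>j. n $ j < CARD('x)}"
    using block_card_le by (auto elim!: face_coeff_nonzeroE intro: less_le_trans)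
qed (rule finite_vec_box)

text \<open>Every block size is at most \<open>CARD('x)\<close>, so all one-variable expansions run
  over the same range. The product of sums becomes a sum over a box of vectors, which can be
  exchanged with the sum over faces.\<close>

lemma card_monomials_degree_eq_binomial_comb:
  assumes v: "\<And>j. 0 < v $ j"
  shows "of_nat (card {m. Poly_Mapping.keys m \<in> D \<and> deg m = v})
    = binomial_comb (face_coeff D) (\<chi> j. of_nat (v $ j))"
proof -
  let ?M = "CARD('x)"
  let ?B = "\<lambda>n j. (of_nat (v $ j) + of_nat (n $ j)) gchoose (n $ j) :: rat"
  have "of_nat (card {m. Poly_Mapping.keys m \<in> D \<and> deg m = v})
      = (\<Sum>G\<in>D. \<Prod>j\<in>UNIV. of_nat (compositions (v $ j) (block_card G j)) :: rat)"
    by (simp add: card_monomials_degree)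
  also have "\<dots> = (\<Sum>G\<in>D. \<Prod>j\<in>UNIV. \<Sum>n<?M. comp_coeff (block_card G j) n
      * ((of_nat (v $ j) + of_nat n) gchoose n))"
    using v block_card_le by (intro sum.cong prod.cong refl compositions_eq_gbinomial_sum) auto
  also have "\<dots> = (\<Sum>G\<in>D. \<Sum>n | \<forall>j. n $ j < ?M.
      (\<Prod>j\<in>UNIV. comp_coeff (block_card G j) (n $ j)) * (\<Prod>j\<in>UNIV. ?B n j))"
    by (subst prod_sum_vec) (simp add: prod.distrib)
  also have "\<dots> = (\<Sum>n | \<forall>j. n $ j < ?M. face_coeff D n * (\<Prod>j\<in>UNIV. ?B n j))"
    by (subst sum.swap) (simp add: face_coeff_def sum_distrib_right)
  also have "\<dots> = binomial_comb (face_coeff D) (\<chi> j. of_nat (v $ j))"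
    using block_card_le
    by (subst binomial_comb_superset[OF finite_vec_box[of ?M]])
      (auto elim!: face_coeff_nonzeroE intro: less_le_trans)
  finally show ?thesis .
qed

text \<open>A face with no block smaller than in \<open>F\<close> has the same block sizes as
  \<open>F\<close>, because \<open>F\<close> has the largest cardinality. Any other face contributes
  a vanishing factor. The surviving summands are all 1, so nothing cancels.\<close>

lemma face_coeff_facet_pos:
  assumes F: "F \<in> D" "\<And>j. 0 < block_card F j" and max: "\<And>G. G \<in> D \<Longrightarrow> card G \<le> card F"
  shows "0 < face_coeff D (\<chi> j. block_card F j - 1)"
proof -
  let ?n = "\<chi> j. block_card F j - 1"
  have summand: "(\<Prod>j\<in>UNIV. comp_coeff (block_card G j) (?n $ j)) = (if \<forall>j. block_card G j = block_card F j then 1 else 0)"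
    if G: "G \<in> D" for G
  proof (cases "\<forall>j. block_card G j = block_card F j")
    case True
    then show ?thesis using F(2) by (simp add: comp_coeff_def)
  next
    case False
    have "\<exists>j. block_card G j < block_card F j"
    proof (rule ccontr)
      assume "\<not> (\<exists>j. block_card G j < block_card F j)"
      then have le: "block_card F j \<le> block_card G j" for j by (simp add: not_less)
      moreover have "\<exists>j. block_card F j < block_card G j"
        using False le by (simp add: order.strict_iff_order) metis
      ultimately have "(\<Sum>j\<in>UNIV. block_card F j) < (\<Sum>j\<in>UNIV. block_card G j)"
        by (intro sum_strict_mono_ex1) auto
      then show False using max[OF G] by (simp add: sum_block_card)
    qed
    then obtain j where "block_card G j < block_card F j" by blast
    then have "comp_coeff (block_card G j) (?n $ j) = 0" by (simp add: comp_coeff_def)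
    then show ?thesis using False by (auto intro!: prod_zero)
  qed
  have "face_coeff D ?n = (\<Sum>G\<in>D. if \<forall>j. block_card G j = block_card F j then 1 else 0)"
    unfolding face_coeff_def using summand by (intro sum.cong) auto
  also have "\<dots> > 0" using F by (intro sum_pos2[of D F]) auto
  finally show ?thesis .
qed

end

section \<open>Quotients of polynomial rings\<close>

lemma ring_of_type_algebra_simps [simp]:
  "carrier (ring_of_type_algebra :: 'a::comm_ring_1 ring) = UNIV"
  "f \<otimes>\<^bsub>ring_of_type_algebra\<^esub> g = f * g"
  "f \<oplus>\<^bsub>ring_of_type_algebra\<^esub> g = f + g"
  "\<one>\<^bsub>ring_of_type_algebra\<^esub> = (1 :: 'a)"
  "\<zero>\<^bsub>ring_of_type_algebra\<^esub> = (0 :: 'a)"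
  by (simp_all add: ring_of_type_algebra_def)

lemma ideal_ring_of_type_algebraI:
  fixes I :: "'a::comm_ring_1 set"
  assumes "0 \<in> I" "\<And>f g. f \<in> I \<Longrightarrow> g \<in> I \<Longrightarrow> f + g \<in> I" "\<And>r f. f \<in> I \<Longrightarrow> r * f \<in> I"
  shows "ideal I ring_of_type_algebra"
proof (rule idealI)
  interpret cring "ring_of_type_algebra :: 'a ring" by (rule cring_from_type_algebra)
  show "ring (ring_of_type_algebra :: 'a ring)" by (rule ring_from_type_algebra)
  have minus: "\<ominus>\<^bsub>ring_of_type_algebra\<^esub> f = - f" for f :: 'a
    by (rule minus_equality) simp_all
  show "subgroup I (add_monoid ring_of_type_algebra)"
  proof (rule add.subgroupI)
    fix f assume "f \<in> I"
    with assms(3)[of f "- 1"] show "\<ominus>\<^bsub>ring_of_type_algebra\<^esub> f \<in> I" by (simp add: minus)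
  qed (use assms in auto)
qed (use assms in \<open>auto simp: mult.commute\<close>)

lemma ideal_ring_of_type_algebraD:
  fixes I :: "'a::comm_ring_1 set"
  assumes "ideal I ring_of_type_algebra"
  shows "0 \<in> I" "f \<in> I \<Longrightarrow> g \<in> I \<Longrightarrow> f + g \<in> I" "f \<in> I \<Longrightarrow> r * f \<in> I"
    "f \<in> I \<Longrightarrow> g \<in> I \<Longrightarrow> f - g \<in> I"
proof -
  interpret ideal I ring_of_type_algebra by fact
  show "0 \<in> I" using additive_subgroup.zero_closed[OF ideal.axioms(1)[OF assms]] by simp
  show add: "f + g \<in> I" if "f \<in> I" "g \<in> I" for f g using additive_subgroup.a_closed[OF ideal.axioms(1)[OF assms] that] by simp
  show mult: "r * f \<in> I" if "f \<in> I" for r f using I_l_closed that by simp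
  show "f - g \<in> I" if "f \<in> I" "g \<in> I" using add[OF that(1) mult[OF that(2), of "- 1"]] by simp
qed

lemma ideal_sum_mem:
  fixes I :: "'a::comm_ring_1 set"
  assumes "ideal I ring_of_type_algebra" "\<And>x. x \<in> A \<Longrightarrow> f x \<in> I"
  shows "(\<Sum>x\<in>A. f x) \<in> I"
  using assms(2)
  by (induction A rule: infinite_finite_induct) (auto intro: ideal_ring_of_type_algebraD[OF assms(1)])

definition coset :: "'a::comm_ring_1 set \<Rightarrow> 'a \<Rightarrow> 'a set"
  where "coset J f = J +>\<^bsub>ring_of_type_algebra\<^esub> f"

locale quotient_by_ideal =
  fixes J :: "('x::finite, 'k::field) mpoly set"
  assumes ideal_J: "ideal J mpoly_ring"
begin

abbreviation "R \<equiv> quot_ring J"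

sublocale S: cring "mpoly_ring :: ('x, 'k) mpoly ring"
  by (rule cring_from_type_algebra)

sublocale J: ideal J mpoly_ring
  by (rule ideal_J)

lemma cring_R: "cring R"
  unfolding quot_ring_def by (rule J.quotient_is_cring) (rule S.is_cring)

sublocale R: cring R
  by (rule cring_R)

lemma coset_eq_iff: "coset J f = coset J g \<longleftrightarrow> f - g \<in> J"
proof
  assume "coset J f = coset J g"
  moreover have "f \<in> coset J f" using J.a_rcos_self[of f] by (simp add: coset_def)
  ultimately obtain h where "h \<in> J" "f = h + g"
    by (auto simp: coset_def a_r_coset_def')
  then show "f - g \<in> J" by simp
next
  assume *: "f - g \<in> J"
  have "f \<in> coset J g" unfolding coset_def a_r_coset_def' using * by (auto intro!: bexI[of _ "f - g"])
  then show "coset J f = coset J g"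
    unfolding coset_def using J.a_repr_independence'[of f g] by simp
qed

lemma coset_ring_hom_ring: "ring_hom_ring mpoly_ring R (coset J)"
  using J.rcos_ring_hom_ring by (simp add: quot_ring_def coset_def[abs_def])

lemma coset_simps:
  "coset J f \<otimes>\<^bsub>R\<^esub> coset J g = coset J (f * g)"
  "coset J f \<oplus>\<^bsub>R\<^esub> coset J g = coset J (f + g)"
  "\<one>\<^bsub>R\<^esub> = coset J 1" "\<zero>\<^bsub>R\<^esub> = coset J 0"
proof -
  interpret h: ring_hom_ring mpoly_ring R "coset J" by (rule coset_ring_hom_ring)
  show "coset J f \<otimes>\<^bsub>R\<^esub> coset J g = coset J (f * g)" using h.hom_mult[of f g] by simp
  show "coset J f \<oplus>\<^bsub>R\<^esub> coset J g = coset J (f + g)" using h.hom_add[of f g] by simp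
  show "\<one>\<^bsub>R\<^esub> = coset J 1" "\<zero>\<^bsub>R\<^esub> = coset J 0" using h.hom_one h.hom_zero by simp_all
qed

lemma carrier_R: "carrier R = range (coset J)"
  by (auto simp: quot_ring_def coset_def FactRing_def A_RCOSETS_def')

lemma quot_scalars_eq: "quot_scalars J = range (\<lambda>c. coset J (Poly_Mapping.single 0 c))"
  by (simp add: quot_scalars_def coset_def)

lemma quot_piece_eq: "quot_piece d J v = coset J ` mpoly_piece d v"
  by (simp add: quot_piece_def coset_def[abs_def])

text \<open>The hypothesis says that the quotient is not the zero ring, so the field of constants
  embeds.\<close>

lemma subfield_quot_scalars:
  assumes "1 \<notin> J"
  shows "subfield (quot_scalars J) R"
proof -
  let ?h = "\<lambda>c::'k. coset J (Poly_Mapping.single 0 c)"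
  interpret k: field "ring_of_type_algebra :: 'k ring" by (rule field_from_type_algebra)
  interpret h: ring_hom_ring "ring_of_type_algebra :: 'k ring" R ?h
    by (rule ring_hom_ringI)
      (auto simp: k.ring_axioms R.ring_axioms carrier_R coset_simps mult_single single_add)
  have "\<one>\<^bsub>R\<^esub> \<noteq> \<zero>\<^bsub>R\<^esub>" using assms by (simp add: coset_simps coset_eq_iff)
  from h.img_is_subfield(2)[OF k.carrier_is_subfield this] show ?thesis
    by (simp add: quot_scalars_eq)
qed

end

section \<open>Stanley--Reisner ideals\<close>

text \<open>Ideals are described by a test on monomials instead of by generators. A complex
  \<open>D\<close> gives its Stanley-Reisner ideal, and \<open>Pow G\<close> gives the ideal
  generated by the variables outside \<open>G\<close>.\<close>

definition face_ideal :: "'x set set \<Rightarrow> ('x, 'k::zero) mpoly set"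
  where "face_ideal D = {f. \<forall>m\<in>Poly_Mapping.keys f. Poly_Mapping.keys m \<notin> D}"

lemma keys_add_nat: "Poly_Mapping.keys (m + n) = Poly_Mapping.keys m \<union> Poly_Mapping.keys n"
  for m n :: "'x \<Rightarrow>\<^sub>0 nat"
  by (auto simp: in_keys_iff lookup_add)

text \<open>Multiplication only enlarges supports, and a superset of a non-face is a
  non-face.\<close>

lemma ideal_face_ideal:
  assumes down: "\<And>G H. G \<in> D \<Longrightarrow> H \<subseteq> G \<Longrightarrow> H \<in> D"
  shows "ideal (face_ideal D :: ('x, 'k::field) mpoly set) mpoly_ring"
proof (rule ideal_ring_of_type_algebraI)
  show "f + g \<in> face_ideal D" if "f \<in> face_ideal D" "g \<in> face_ideal D" for f g :: "('x, 'k) mpoly"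
    using that keys_add[of f g] by (auto simp: face_ideal_def)
  show "r * f \<in> face_ideal D" if f: "f \<in> face_ideal D" for r f :: "('x, 'k) mpoly"
    unfolding face_ideal_def
  proof (intro CollectI ballI notI)
    fix m assume "m \<in> Poly_Mapping.keys (r * f)" and D: "Poly_Mapping.keys m \<in> D"
    then obtain m1 m2 where m: "m = m1 + m2" "m2 \<in> Poly_Mapping.keys f"
      using keys_mult[of r f] by blast
    then have "Poly_Mapping.keys m2 \<in> D" using down[OF D] by (simp add: keys_add_nat)
    then show False using f m by (auto simp: face_ideal_def)
  qed
qed (simp add: face_ideal_def)

definition exponent_indicator :: "'x set \<Rightarrow> 'x \<Rightarrow>\<^sub>0 nat"
  where "exponent_indicator F = (\<Sum>i\<in>F. Poly_Mapping.single i 1)"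

lemma lookup_exponent_indicator:
  "Poly_Mapping.lookup (exponent_indicator F) i = (if i \<in> F then 1 else 0)" for F :: "'x::finite set"
  by (simp add: exponent_indicator_def lookup_sum lookup_single when_def)

lemma keys_exponent_indicator [simp]: "Poly_Mapping.keys (exponent_indicator F) = F"
  for F :: "'x::finite set"
  by (auto simp: in_keys_iff lookup_exponent_indicator split: if_splits)

lemma mpoly_sum_monomials:
  "f = (\<Sum>m\<in>Poly_Mapping.keys f. Poly_Mapping.single m (Poly_Mapping.lookup f m))"
  by (rule poly_mapping_eqI) (simp add: lookup_sum lookup_single when_def in_keys_iff)

text \<open>A monomial lies in \<open>J\<close> as soon as the squarefree monomial on some part of
  its support does. This gives downward closure and one inclusion; the other holds because the
  right-hand side is an ideal containing the generators.\<close>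

lemma stanley_reisner:
  fixes J :: "('x::finite, 'k::field) mpoly set"
  assumes "squarefree_monomial_ideal J"
  shows "\<And>G H. G \<in> stanley_reisner_complex J \<Longrightarrow> H \<subseteq> G \<Longrightarrow> H \<in> stanley_reisner_complex J"
    and "J = face_ideal (stanley_reisner_complex J)"
proof -
  interpret S: cring "mpoly_ring :: ('x, 'k) mpoly ring" by (rule cring_from_type_algebra)
  let ?D = "stanley_reisner_complex J"
  obtain \<F> where J: "J = genideal mpoly_ring (squarefree_monomial ` \<F>)"
    using assms by (auto simp: squarefree_monomial_ideal_def)
  have ideal: "ideal J mpoly_ring" unfolding J by (rule S.genideal_ideal) simp
  note I = ideal_ring_of_type_algebraD[OF ideal]
  have sqf: "squarefree_monomial F = Poly_Mapping.single (exponent_indicator F) 1" for F :: "'x set"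
    by (simp add: squarefree_monomial_def exponent_indicator_def)
  have monomial_mem: "Poly_Mapping.single m c \<in> J"
    if "F \<subseteq> Poly_Mapping.keys m" "squarefree_monomial F \<in> J" for m c F
  proof -
    have "Poly_Mapping.single m c
        = Poly_Mapping.single (m - exponent_indicator F) c * squarefree_monomial F"
    proof -
      have "m - exponent_indicator F + exponent_indicator F = m"
      proof (rule poly_mapping_eqI)
        fix i
        have "Poly_Mapping.lookup (exponent_indicator F) i \<le> Poly_Mapping.lookup m i"
          using that(1) by (auto simp: lookup_exponent_indicator in_keys_iff Suc_le_eq)
        then show "Poly_Mapping.lookup (m - exponent_indicator F + exponent_indicator F) i
            = Poly_Mapping.lookup m i"
          by (simp add: lookup_add lookup_minus)
      qed
      then show ?thesis by (simp add: sqf mult_single)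
    qed
    then show ?thesis using I(3)[OF that(2)] by metis
  qed
  show down: "H \<in> ?D" if "G \<in> ?D" "H \<subseteq> G" for G H
    using that monomial_mem[of H "exponent_indicator G" 1]
    by (auto simp: stanley_reisner_complex_def sqf)
  show "J = face_ideal ?D"
  proof (intro equalityI subsetI)
    have "squarefree_monomial F \<in> J" if "F \<in> \<F>" for F
      using S.genideal_self[of "squarefree_monomial ` \<F>"] that J by auto
    then have "squarefree_monomial ` \<F> \<subseteq> (face_ideal ?D :: ('x, 'k) mpoly set)"
      by (auto simp: face_ideal_def sqf stanley_reisner_complex_def)
    from S.genideal_minimal[OF ideal_face_ideal[OF down] this]
    have "J \<subseteq> face_ideal ?D" unfolding J[symmetric] by simp
    then show "f \<in> face_ideal ?D" if "f \<in> J" for f using that by blast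
    fix f :: "('x, 'k) mpoly" assume f: "f \<in> face_ideal ?D"
    have "Poly_Mapping.single m (Poly_Mapping.lookup f m) \<in> J" if "m \<in> Poly_Mapping.keys f" for m
      using f that monomial_mem[of "Poly_Mapping.keys m" m]
      by (auto simp: face_ideal_def stanley_reisner_complex_def)
    then show "f \<in> J" by (subst mpoly_sum_monomials) (rule ideal_sum_mem[OF ideal])
  qed
qed

text \<open>Serves two purposes: restricting to the face monomials gives the normal form modulo
  \<open>J\<close>, and restricting to the monomials of one degree gives a homogeneous
  component.\<close>

lift_definition restrict_keys :: "'a set \<Rightarrow> ('a \<Rightarrow>\<^sub>0 'b::zero) \<Rightarrow> 'a \<Rightarrow>\<^sub>0 'b"
  is "\<lambda>A f a. if a \<in> A then f a else 0"
  by (rule finite_subset[rotated]) auto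

lemma lookup_restrict_keys [simp]:
  "Poly_Mapping.lookup (restrict_keys A f) a = (if a \<in> A then Poly_Mapping.lookup f a else 0)"
  by transfer simp

lemma keys_restrict_keys: "Poly_Mapping.keys (restrict_keys A f) = Poly_Mapping.keys f \<inter> A"
  by (auto simp: in_keys_iff split: if_splits)

locale stanley_reisner_ring = standard_graded d b
  for d :: "'x::finite \<Rightarrow> nat ^ 'p::finite" and b :: "'x \<Rightarrow> 'p" +
  fixes D :: "'x set set" and J :: "('x, 'k::field) mpoly set"
  assumes down: "G \<in> D \<Longrightarrow> H \<subseteq> G \<Longrightarrow> H \<in> D" and J_eq: "J = face_ideal D"
begin

sublocale quotient_by_ideal J
  by (rule quotient_by_ideal.intro) (simp add: J_eq ideal_face_ideal down)

definition face_monomials :: "('x \<Rightarrow>\<^sub>0 nat) set"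
  where "face_monomials = {m. Poly_Mapping.keys m \<in> D}"

lemma diff_restrict_face_monomials_mem: "f - restrict_keys face_monomials f \<in> J"
  by (auto simp: J_eq face_ideal_def face_monomials_def in_keys_iff lookup_minus)

lemma mem_J_iff: "f \<in> J \<longleftrightarrow> restrict_keys face_monomials f = 0"
  by (auto simp: J_eq face_ideal_def face_monomials_def poly_mapping_eq_iff fun_eq_iff in_keys_iff)

text \<open>The predicate \<open>dimension\<close> is built from line extensions, hence the
  induction over \<open>A\<close>. A new monomial is not in the old span, because the difference
  would have a face monomial among its keys and could not lie in \<open>J\<close>.\<close>

lemma dimension_span_monomials:
  assumes "finite A" "A \<subseteq> face_monomials"
  shows "R.dimension (card A) (quot_scalars J) (coset J ` {f. Poly_Mapping.keys f \<subseteq> A})"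
  using assms
proof (induction A rule: finite_induct)
  case empty
  have "coset J ` {f. Poly_Mapping.keys f \<subseteq> {}} = {\<zero>\<^bsub>R\<^esub>}" by (simp add: coset_simps)
  then show ?case using R.zero_dim by simp
next
  case (insert m A)
  let ?K = "quot_scalars J" and ?E = "\<lambda>A. coset J ` {f. Poly_Mapping.keys f \<subseteq> A}"
  let ?v = "coset J (Poly_Mapping.single m 1)"
  have "?v \<notin> ?E A"
  proof
    assume "?v \<in> ?E A"
    then obtain f where f: "Poly_Mapping.keys f \<subseteq> A" "Poly_Mapping.single m 1 - f \<in> J"
      by (auto simp: coset_eq_iff)
    have "m \<notin> Poly_Mapping.keys f" using f(1) insert by blast
    then have "m \<in> Poly_Mapping.keys (Poly_Mapping.single m 1 - f)"
      by (simp add: in_keys_iff lookup_minus)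
    then show False using f(2) insert.prems by (auto simp: J_eq face_ideal_def face_monomials_def)
  qed
  then have "R.dimension (Suc (card A)) ?K (R.line_extension ?K ?v (?E A))"
    using insert by (intro R.Suc_dim) (auto simp: carrier_R)
  moreover have "R.line_extension ?K ?v (?E A) = ?E (insert m A)"
  proof (intro equalityI subsetI)
    fix u assume "u \<in> R.line_extension ?K ?v (?E A)"
    then obtain c f where f: "Poly_Mapping.keys f \<subseteq> A" and "u = coset J (Poly_Mapping.single m c + f)"
      by (auto simp: R.line_extension_mem_iff quot_scalars_eq coset_simps mult_single)
    moreover have "Poly_Mapping.keys (Poly_Mapping.single m c + f) \<subseteq> insert m A"
      using f by (auto simp: in_keys_iff lookup_add lookup_single when_def split: if_splits)
    ultimately show "u \<in> ?E (insert m A)" by blast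
  next
    fix u assume "u \<in> ?E (insert m A)"
    then obtain f where f: "Poly_Mapping.keys f \<subseteq> insert m A" "u = coset J f" by auto
    define g where "g = f - Poly_Mapping.single m (Poly_Mapping.lookup f m)"
    have g: "Poly_Mapping.keys g \<subseteq> A"
      using f(1) by (auto simp: g_def in_keys_iff lookup_minus lookup_single when_def split: if_splits)
    have "u = coset J (Poly_Mapping.single 0 (Poly_Mapping.lookup f m)) \<otimes>\<^bsub>R\<^esub> ?v \<oplus>\<^bsub>R\<^esub> coset J g"
      by (simp add: f coset_simps mult_single g_def)
    then show "u \<in> R.line_extension ?K ?v (?E A)"
      unfolding R.line_extension_mem_iff quot_scalars_eq using g by blast
  qed
  ultimately show ?case using insert by simp
qed

lemma quot_piece_eq_span:
  "quot_piece d J v = coset J ` {f. Poly_Mapping.keys f \<subseteq> {m. Poly_Mapping.keys m \<in> D \<and> deg m = v}}"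
proof (intro equalityI subsetI)
  fix u assume "u \<in> quot_piece d J v"
  then obtain f where f: "f \<in> mpoly_piece d v" "u = coset J f" by (auto simp: quot_piece_eq)
  let ?g = "restrict_keys face_monomials f"
  have "u = coset J ?g" using diff_restrict_face_monomials_mem f by (simp add: coset_eq_iff)
  moreover have "Poly_Mapping.keys ?g \<subseteq> {m. Poly_Mapping.keys m \<in> D \<and> deg m = v}"
    using f by (auto simp: keys_restrict_keys mpoly_piece_def face_monomials_def)
  ultimately show "u \<in> coset J ` {f. Poly_Mapping.keys f \<subseteq> {m. Poly_Mapping.keys m \<in> D \<and> deg m = v}}"
    by blast
qed (auto simp: quot_piece_eq mpoly_piece_def)

text \<open>The dimension is a definite description. Its uniqueness comes from the subfield property
  when \<open>1 \<notin> J\<close> and is shown by hand otherwise.\<close>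

lemma hilbert_function_eq:
  "hilbert_function R (quot_scalars J) (quot_piece d J) v
    = card {m. Poly_Mapping.keys m \<in> D \<and> deg m = v}" (is "_ = card ?M")
proof -
  have dim: "R.dimension (card ?M) (quot_scalars J) (quot_piece d J v)"
    unfolding quot_piece_eq_span
    by (intro dimension_span_monomials finite_monomials_degree) (auto simp: face_monomials_def)
  show ?thesis
  proof (cases "1 \<in> J")
    case False
    then show ?thesis
      using R.dimI[OF subfield_quot_scalars dim] by (simp add: hilbert_function_def over_def)
  next
    case True
    \<comment> \<open>the zero ring, over which \<open>quot_scalars J\<close> is not a field\<close>
    then have univ: "J = UNIV"
      using ideal_ring_of_type_algebraD(3)[OF ideal_J, of 1] by auto
    have trivial: "u = \<zero>\<^bsub>R\<^esub>" if "u \<in> carrier R" for u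
    proof -
      obtain f where "u = coset J f" using \<open>u \<in> carrier R\<close> unfolding carrier_R by blast
      moreover have "coset J f = coset J 0" unfolding coset_eq_iff by (simp add: univ)
      ultimately show ?thesis by (simp add: coset_simps)
    qed
    \<comment> \<open>A line extension requires a vector outside a space containing zero, and here
      zero is the only vector.\<close>
    have dim_0: "n = 0" if "R.dimension n K E" for n K E
      using that
    proof (induction rule: R.dimension.induct)
      case (Suc_dim v E n K)
      then have "R.dimension 0 K E" by simp
      then have "E = {\<zero>\<^bsub>R\<^esub>}" by (cases rule: R.dimension.cases) auto
      with Suc_dim trivial show ?case by blast
    qed simp
    have "(THE n. R.dimension n (quot_scalars J) (quot_piece d J v)) = card ?M"
      by (rule the_equality) (use dim dim_0 in metis)+
    then show ?thesis by (simp add: hilbert_function_def R.dim_def)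
  qed
qed

text \<open>The expansion of the monomial count holds in all positive degrees, so the all-ones
  vector serves as threshold.\<close>

lemma multidegree_eq: "multidegree d J = face_coeff D"
proof (rule multidegree_eqI[of _ "\<chi> j. 1"])
  fix v :: "nat ^ 'p" assume "(\<chi> j. 1) \<le> v"
  then have "0 < v $ j" for j by (simp add: less_eq_vec_def Suc_le_eq)
  then show "of_nat (hilbert_function R (quot_scalars J) (quot_piece d J) v)
      = binomial_comb (face_coeff D) (\<chi> i. of_nat (v $ i))"
    by (simp add: hilbert_function_eq card_monomials_degree_eq_binomial_comb)
qed (rule finite_face_coeff_support)

end

section \<open>The space of relevant homogeneous primes\<close>

lemma closedin_multiproj_space_iff:
  "closedin (multiproj_space R gr) Y \<longleftrightarrow> (\<exists>T\<subseteq>carrier R. Y = {P\<in>multiproj R gr. T \<subseteq> P})"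
proof -
  \<comment> \<open>As primes are proper, the open set given by the whole carrier is the full
    spectrum, which identifies \<open>topspace\<close>.\<close>
  have proper: "\<not> carrier R \<subseteq> P" if "primeideal P R" for P
  proof -
    interpret primeideal P R by fact
    show ?thesis using I_notcarr a_subset by blast
  qed
  have top: "topspace (zariski_topology R) = {P. primeideal P R}"
  proof (intro equalityI subsetI)
    fix P assume "P \<in> topspace (zariski_topology R)"
    then show "P \<in> {P. primeideal P R}" by (auto simp: topspace_def openin_zariski)
  next
    fix P assume "P \<in> {P. primeideal P R}"
    then have "P \<in> {P. primeideal P R \<and> \<not> carrier R \<subseteq> P}" using proper by auto
    moreover have "openin (zariski_topology R) {P. primeideal P R \<and> \<not> carrier R \<subseteq> P}"
      unfolding openin_zariski by blast
    ultimately show "P \<in> topspace (zariski_topology R)" unfolding topspace_def by blast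
  qed
  have closed: "closedin (zariski_topology R) C \<longleftrightarrow> (\<exists>T\<subseteq>carrier R. C = {P. primeideal P R \<and> T \<subseteq> P})" for C
  proof -
    have *: "C \<subseteq> {P. primeideal P R} \<and> {P. primeideal P R} - C = {P. primeideal P R \<and> \<not> T \<subseteq> P}
        \<longleftrightarrow> C = {P. primeideal P R \<and> T \<subseteq> P}" for T by blast
    show ?thesis
      unfolding closedin_def top openin_zariski ex_simps(2)[symmetric]
      by (rule ex_cong1) (subst *[symmetric], rule conj_left_commute)
  qed
  have "{P. primeideal P R \<and> T \<subseteq> P} \<inter> multiproj R gr = {P\<in>multiproj R gr. T \<subseteq> P}" for T
    by (auto simp: multiproj_def)
  then show ?thesis
    unfolding multiproj_space_def closedin_subtopology closed by auto
qed

context quotient_by_ideal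
begin

text \<open>Transfers a prime of the quotient to the polynomial ring, where one computes with
  polynomials rather than cosets.\<close>

lemma coset_preimage_prime:
  assumes "primeideal P R"
  defines "Q \<equiv> {f. coset J f \<in> P}"
  shows "ideal Q mpoly_ring" "1 \<notin> Q" "f * g \<in> Q \<Longrightarrow> f \<in> Q \<or> g \<in> Q" "J \<subseteq> Q"
proof -
  interpret primeideal P R by fact
  show "ideal Q mpoly_ring"
    using ring_hom_ring.ideal_vimage[OF coset_ring_hom_ring ideal_axioms] by (simp add: Q_def)
  show "1 \<notin> Q" using one_imp_carrier I_notcarr by (auto simp: Q_def coset_simps)
  show "f \<in> Q \<or> g \<in> Q" if "f * g \<in> Q"
    using I_prime[of "coset J f" "coset J g"] that by (auto simp: Q_def coset_simps carrier_R)
  show "J \<subseteq> Q"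
  proof
    fix f assume "f \<in> J"
    then have "coset J f = \<zero>\<^bsub>R\<^esub>" by (simp add: coset_simps coset_eq_iff)
    then show "f \<in> Q" using additive_subgroup.zero_closed[OF is_additive_subgroup] by (simp add: Q_def)
  qed
qed

lemma coset_mem_image_iff:
  assumes "ideal Q mpoly_ring" "J \<subseteq> Q"
  shows "coset J f \<in> coset J ` Q \<longleftrightarrow> f \<in> Q"
proof
  assume "coset J f \<in> coset J ` Q"
  then obtain g where "g \<in> Q" "f - g \<in> J" by (auto simp: coset_eq_iff)
  then show "f \<in> Q" using ideal_ring_of_type_algebraD(2)[OF assms(1), of g "f - g"] assms(2) by auto
qed auto

lemma ideal_coset_image:
  assumes "ideal Q mpoly_ring"
  shows "ideal (coset J ` Q) R"
  using S.ring_ideal_imp_quot_ideal[OF ideal_J assms]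
  by (simp add: quot_ring_def coset_def[abs_def])

lemma primeideal_coset_image:
  assumes Q: "ideal Q mpoly_ring" "J \<subseteq> Q" and "1 \<notin> Q"
    and prime: "\<And>f g. f * g \<in> Q \<Longrightarrow> f \<in> Q \<or> g \<in> Q"
  shows "primeideal (coset J ` Q) R"
proof (rule primeidealI)
  show "carrier R \<noteq> coset J ` Q"
    using coset_mem_image_iff[OF Q, of 1] \<open>1 \<notin> Q\<close> by (auto simp: carrier_R)
  show "u \<in> coset J ` Q \<or> w \<in> coset J ` Q"
    if "u \<in> carrier R" "w \<in> carrier R" "u \<otimes>\<^bsub>R\<^esub> w \<in> coset J ` Q" for u w
  proof -
    from that(1,2) obtain f g where fg: "u = coset J f" "w = coset J g" unfolding carrier_R by blast
    then have "f * g \<in> Q" using that(3) by (simp add: coset_simps coset_mem_image_iff[OF Q])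
    then show ?thesis using prime fg by blast
  qed
qed (use ideal_coset_image[OF Q(1)] cring_R in auto)

end

text \<open>Primality is pulled back from the domain of univariate polynomials. The substitution is
  multiplicative for any weights; they only have to separate the monomials of \<open>f\<close> and
  \<open>g\<close>, so that neither factor is sent to 0.\<close>

lemma face_ideal_Pow_prime:
  fixes f g :: "('x::finite, 'k::field) mpoly"
  assumes fg: "f * g \<in> face_ideal (Pow G)"
  shows "f \<in> face_ideal (Pow G) \<or> g \<in> face_ideal (Pow G)"
proof (rule ccontr)
  assume "\<not> ?thesis"
  then have nmem: "f \<notin> face_ideal (Pow G)" "g \<notin> face_ideal (Pow G)" by auto
  \<comment> \<open>the substitution \<open>x\<^sub>i \<mapsto> T ^ w i\<close> for \<open>i \<in> G\<close> and \<open>x\<^sub>i \<mapsto> 0\<close> otherwise kills the ideal\<close>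
  obtain w :: "'x \<Rightarrow> nat" where
    inj: "inj_on (\<lambda>m. \<Sum>i\<in>UNIV. Poly_Mapping.lookup m i * w i) (Poly_Mapping.keys f \<union> Poly_Mapping.keys g)"
    using exists_injective_weights[of "Poly_Mapping.keys f \<union> Poly_Mapping.keys g"] by auto
  let ?W = "\<lambda>m. \<Sum>i\<in>UNIV. Poly_Mapping.lookup m i * w i"
  define \<phi> where "\<phi> m = (if Poly_Mapping.keys m \<subseteq> G then Polynomial.monom (1::'k) (?W m) else 0)" for m
  define \<Phi> where "\<Phi> = mpoly_hom (\<lambda>c. [:c:]) \<phi>"
  have \<phi>_add: "\<phi> (m + n) = \<phi> m * \<phi> n" for m n
    by (auto simp: \<phi>_def keys_add_nat mult_monom lookup_add distrib_right sum.distrib)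
  have mult: "\<Phi> (f * g) = \<Phi> f * \<Phi> g"
    unfolding \<Phi>_def by (rule mpoly_hom_mult) (auto simp: \<phi>_add mult_ac)
  have "\<Phi> (f * g) = 0"
    using fg unfolding \<Phi>_def mpoly_hom_def by (intro sum.neutral) (auto simp: face_ideal_def \<phi>_def)
  moreover have "\<Phi> h \<noteq> 0" if h: "h \<notin> face_ideal (Pow G)" and inj: "inj_on ?W (Poly_Mapping.keys h)" for h
  proof -
    obtain m where m: "m \<in> Poly_Mapping.keys h" "Poly_Mapping.keys m \<subseteq> G"
      using h by (auto simp: face_ideal_def)
    have "Polynomial.coeff (\<Phi> h) (?W m)
        = (\<Sum>n\<in>Poly_Mapping.keys h. if n = m then Poly_Mapping.lookup h n else 0)"
      unfolding \<Phi>_def mpoly_hom_def Polynomial.coeff_sum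
      using m inj by (intro sum.cong) (auto simp: \<phi>_def dest: inj_onD)
    also have "\<dots> = Poly_Mapping.lookup h m" using m by simp
    finally show ?thesis using m by (auto simp: in_keys_iff)
  qed
  ultimately show False using mult nmem inj by (auto simp: inj_on_Un)
qed

section \<open>Monomial primes of faces and the lower bound for the dimension\<close>

context stanley_reisner_ring
begin

definition face_prime :: "'x set \<Rightarrow> ('x, 'k) mpoly set set"
  where "face_prime G = coset J ` face_ideal (Pow G)"

lemma ideal_face_ideal_Pow: "ideal (face_ideal (Pow G) :: ('x, 'k) mpoly set) mpoly_ring"
  by (rule ideal_face_ideal) auto

lemma J_subset_face_ideal_Pow: "G \<in> D \<Longrightarrow> J \<subseteq> face_ideal (Pow G)"
  using down by (auto simp: J_eq face_ideal_def)

lemma coset_mem_face_prime_iff: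
  "G \<in> D \<Longrightarrow> coset J f \<in> face_prime G \<longleftrightarrow> f \<in> face_ideal (Pow G)"
  unfolding face_prime_def
  by (rule coset_mem_image_iff[OF ideal_face_ideal_Pow J_subset_face_ideal_Pow])

text \<open>Homogeneous, because every term of a polynomial in the ideal lies in the ideal.
  Relevant, because the product of the variables in \<open>G\<close> has positive degree in each
  coordinate and stays outside the ideal.\<close>

lemma face_prime_mem_multiproj:
  assumes G: "G \<in> D" and rel: "\<And>j. 0 < block_card G j"
  shows "face_prime G \<in> multiproj R (quot_piece d J)"
proof -
  let ?P = "face_prime G" and ?gr = "quot_piece d J"
  let ?X = "?P \<inter> (\<Union>v. ?gr v)"
  have prime: "primeideal ?P R"
    unfolding face_prime_def
  proof (rule primeideal_coset_image[OF ideal_face_ideal_Pow J_subset_face_ideal_Pow[OF G] _ face_ideal_Pow_prime])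
    show "1 \<notin> (face_ideal (Pow G) :: ('x, 'k) mpoly set)" by (simp add: face_ideal_def)
  qed
  then have ideal: "ideal ?P R" by (rule primeideal.axioms)
  then have sub: "?P \<subseteq> carrier R" by (rule additive_subgroup.a_subset[OF ideal.axioms(1)])
  have X: "?X \<subseteq> carrier R" using sub by blast
  have "?P \<subseteq> genideal R ?X"
  proof
    fix u assume "u \<in> ?P"
    then obtain f where f: "f \<in> face_ideal (Pow G)" "u = coset J f" by (auto simp: face_prime_def)
    \<comment> \<open>Passing to the preimage allows membership to be checked term by term on the
      polynomial \<open>f\<close>.\<close>
    have vim: "ideal {f. coset J f \<in> genideal R ?X} mpoly_ring"
      using ring_hom_ring.ideal_vimage[OF coset_ring_hom_ring R.genideal_ideal[OF X]] by simp
    have "coset J (Poly_Mapping.single m (Poly_Mapping.lookup f m)) \<in> genideal R ?X"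
      if "m \<in> Poly_Mapping.keys f" for m
    proof -
      let ?t = "Poly_Mapping.single m (Poly_Mapping.lookup f m)"
      have "?t \<in> face_ideal (Pow G)" using f that by (auto simp: face_ideal_def)
      moreover have "?t \<in> mpoly_piece d (deg m)" by (auto simp: mpoly_piece_def)
      ultimately have "coset J ?t \<in> ?X" unfolding quot_piece_eq face_prime_def by blast
      then show ?thesis using R.genideal_self[OF X] by blast
    qed
    then have "f \<in> {f. coset J f \<in> genideal R ?X}"
      by (subst mpoly_sum_monomials) (rule ideal_sum_mem[OF vim], simp)
    then show "u \<in> genideal R ?X" using f by simp
  qed
  moreover have "genideal R ?X \<subseteq> ?P" by (rule R.genideal_minimal[OF ideal]) blast
  ultimately have "homogeneous_ideal R ?gr ?P" using ideal by (auto simp: homogeneous_ideal_def)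
  moreover have "\<not> irrelevant_ideal R ?gr \<subseteq> ?P"
  proof
    assume *: "irrelevant_ideal R ?gr \<subseteq> ?P"
    define t :: "('x, 'k) mpoly" where "t = Poly_Mapping.single (exponent_indicator G) 1"
    define v where "v = deg (exponent_indicator G)"
    have "v $ j = block_card G j" for j
      by (simp add: v_def deg_nth lookup_exponent_indicator block_card_def sum.If_cases Int_def conj_commute)
    then have "\<forall>j. 0 < v $ j" using rel by simp
    moreover have "coset J t \<in> ?gr v" by (auto simp: quot_piece_eq mpoly_piece_def t_def v_def)
    ultimately have "coset J t \<in> (\<Union>v\<in>{v. \<forall>j. 0 < v $ j}. ?gr v)" by blast
    moreover have "(\<Union>v\<in>{v. \<forall>j. 0 < v $ j}. ?gr v) \<subseteq> carrier R" by (auto simp: quot_piece_eq carrier_R)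
    ultimately have "coset J t \<in> irrelevant_ideal R ?gr"
      unfolding irrelevant_ideal_def using R.genideal_self by blast
    then have "t \<in> face_ideal (Pow G)" using * coset_mem_face_prime_iff[OF G] by blast
    then show False by (simp add: face_ideal_def t_def)
  qed
  ultimately show ?thesis using prime by (simp add: multiproj_def)
qed

definition face_variety :: "'x set \<Rightarrow> ('x, 'k) mpoly set set set"
  where "face_variety G = {P\<in>multiproj R (quot_piece d J). face_prime G \<subseteq> P}"

text \<open>The prime of \<open>G\<close> is a generic point: a closed set containing it contains
  the whole variety.\<close>

lemma irreducible_closed_face_variety:
  assumes "G \<in> D" "\<And>j. 0 < block_card G j"
  shows "irreducible_closed (multiproj_space R (quot_piece d J)) (face_variety G)"
proof -
  have sub: "face_prime G \<subseteq> carrier R" by (auto simp: face_prime_def carrier_R)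
  have generic: "face_prime G \<in> face_variety G"
    using face_prime_mem_multiproj[OF assms] by (simp add: face_variety_def)
  have *: "face_variety G \<subseteq> C"
    if "closedin (multiproj_space R (quot_piece d J)) C" "face_prime G \<in> C" for C
    using that unfolding closedin_multiproj_space_iff face_variety_def by blast
  have "closedin (multiproj_space R (quot_piece d J)) (face_variety G)"
    unfolding closedin_multiproj_space_iff face_variety_def using sub by blast
  then show ?thesis unfolding irreducible_closed_def using generic * by blast
qed

text \<open>Larger faces have smaller primes. The product of the variables in \<open>G\<close> lies
  in the prime of \<open>H\<close> but not in that of \<open>G\<close>.\<close>

lemma face_variety_strict_mono:
  assumes "H \<subset> G" "G \<in> D" "\<And>j. 0 < block_card H j"
  shows "face_variety H \<subset> face_variety G"
proof
  have "Pow H \<subseteq> Pow G" using assms by blast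
  then have "face_ideal (Pow G) \<subseteq> (face_ideal (Pow H) :: ('x, 'k) mpoly set)"
    unfolding face_ideal_def by blast
  then have "face_prime G \<subseteq> face_prime H" by (auto simp: face_prime_def)
  then show "face_variety H \<subseteq> face_variety G" by (auto simp: face_variety_def)
  have "0 < block_card G j" for j
    using assms(3)[of j] block_card_mono[of H G j] assms(1) by auto
  then have "face_prime G \<in> face_variety G"
    using face_prime_mem_multiproj assms(2) by (simp add: face_variety_def)
  moreover have "\<not> face_prime H \<subseteq> face_prime G"
  proof
    assume *: "face_prime H \<subseteq> face_prime G"
    define t :: "('x, 'k) mpoly" where "t = Poly_Mapping.single (exponent_indicator G) 1"
    have "t \<in> face_ideal (Pow H)" using assms(1) by (auto simp: t_def face_ideal_def)
    then have "coset J t \<in> face_prime G" using * by (auto simp: face_prime_def)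
    then have "t \<in> face_ideal (Pow G)" using coset_mem_face_prime_iff[OF assms(2)] by simp
    then show False by (simp add: t_def face_ideal_def)
  qed
  ultimately show "face_variety H \<noteq> face_variety G" unfolding face_variety_def by blast
qed

text \<open>A transversal \<open>s\<close> picks one vertex of \<open>F\<close> in every block.
  Adding the other vertices of \<open>F\<close> one at a time gives a chain of faces that all meet
  every block.\<close>

lemma dim_multiproj_ge:
  assumes F: "F \<in> D" "\<And>j. 0 < block_card F j"
  shows "ereal (real (card F - CARD('p))) \<le> dim_multiproj d J"
proof -
  have "\<exists>i. i \<in> F \<and> b i = j" for j
    using F(2)[of j] by (auto simp: block_card_def card_gt_0_iff)
  then obtain s where s: "\<And>j. s j \<in> F" "\<And>j. b (s j) = j" by metis
  have "inj s" by (metis injI s(2))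
  then have card_s: "card (range s) = CARD('p)" by (simp add: card_image)
  let ?m = "card F - CARD('p)"
  have "card (F - range s) = ?m" using s card_s by (subst card_Diff_subset) auto
  then obtain e where e: "bij_betw e {0..<?m} (F - range s)"
    using ex_bij_betw_nat_finite[of "F - range s"] by auto
  define G where "G i = range s \<union> e ` {..<i}" for i
  have G_sub: "G i \<subseteq> F" if "i \<le> ?m" for i
    using e s that by (auto simp: G_def bij_betw_def)
  then have G_D: "G i \<in> D" if "i \<le> ?m" for i using down[OF F(1)] that by blast
  have G_rel: "0 < block_card (G i) j" for i j
    using s(2) by (auto simp: G_def block_card_def card_gt_0_iff)
  have G_less: "G i \<subset> G (Suc i)" if "i < ?m" for i
  proof -
    have "e i \<notin> range s" using bij_betwE[OF e] that by auto
    moreover have "e i \<notin> e ` {..<i}" using inj_onD[OF bij_betw_imp_inj_on[OF e], of i] that by fastforce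
    ultimately have "e i \<in> G (Suc i) - G i" by (auto simp: G_def)
    moreover have "G i \<subseteq> G (Suc i)" by (auto simp: G_def)
    ultimately show ?thesis by blast
  qed
  show ?thesis
    unfolding dim_multiproj_def krull_dim_def
  proof (rule Sup_upper, intro CollectI exI conjI allI impI)
    show "ereal (real ?m) = ereal (real ?m)" ..
    show "irreducible_closed (multiproj_space R (quot_piece d J)) (face_variety (G i))" if "i \<le> ?m" for i
      using irreducible_closed_face_variety[OF G_D[OF that] G_rel] .
    show "face_variety (G i) \<subset> face_variety (G (Suc i))" if "i < ?m" for i
      using face_variety_strict_mono[OF G_less[OF that] G_D G_rel] that by simp
  qed
qed

end

section \<open>Independence modulo an ideal\<close>

text \<open>Linear independence of the residue classes, stated on representatives so that it makes
  sense for all ideals of a chain at once.\<close>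

definition independent_mod :: "('x, 'k::field) mpoly set \<Rightarrow> ('x, 'k) mpoly set \<Rightarrow> bool"
  where "independent_mod Q B \<longleftrightarrow> finite B \<and>
    (\<forall>c. (\<Sum>v\<in>B. Poly_Mapping.single 0 (c v) * v) \<in> Q \<longrightarrow> (\<forall>v\<in>B. c v = 0))"

lemma independent_modD:
  assumes "independent_mod Q B" "(\<Sum>v\<in>B. Poly_Mapping.single 0 (c v) * v) \<in> Q"
  shows "\<forall>v\<in>B. c v = 0"
  using assms unfolding independent_mod_def by blast

lemma independent_mod_subset: "independent_mod Q B \<Longrightarrow> Q' \<subseteq> Q \<Longrightarrow> independent_mod Q' B"
  unfolding independent_mod_def by blast

text \<open>Passes from an indexed family to a set. Two indices with equal values would satisfy the
  relation with coefficients 1 and -1, so the family is injective.\<close>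

lemma independent_mod_image:
  assumes fin: "finite I" and "0 \<in> Q"
    and ind: "\<And>c. (\<Sum>i\<in>I. Poly_Mapping.single 0 (c i) * u i) \<in> Q \<Longrightarrow> \<forall>i\<in>I. c i = 0"
  shows "independent_mod Q (u ` I)" "card (u ` I) = card I"
proof -
  have inj: "inj_on u I"
  proof (rule inj_onI, rule ccontr)
    fix i j assume ij: "i \<in> I" "j \<in> I" "u i = u j" "i \<noteq> j"
    define c :: "'a \<Rightarrow> 'c" where "c k = (if k = i then 1 else if k = j then - 1 else 0)" for k
    have "(\<Sum>k\<in>I. Poly_Mapping.single 0 (c k) * u k) = (\<Sum>k\<in>{i, j}. Poly_Mapping.single 0 (c k) * u k)"
      using ij fin by (intro sum.mono_neutral_right) (auto simp: c_def)
    also have "\<dots> = 0" using ij by (simp add: c_def single_uminus)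
    finally have "\<forall>k\<in>I. c k = 0" using ind[of c] \<open>0 \<in> Q\<close> by simp
    then show False using ij by (auto simp: c_def)
  qed
  then show "card (u ` I) = card I" by (rule card_image)
  show "independent_mod Q (u ` I)"
    unfolding independent_mod_def
  proof (intro conjI allI impI)
    fix c assume "(\<Sum>v\<in>u ` I. Poly_Mapping.single 0 (c v) * v) \<in> Q"
    then have "(\<Sum>i\<in>I. Poly_Mapping.single 0 (c (u i)) * u i) \<in> Q" by (simp add: sum.reindex[OF inj])
    then show "\<forall>v\<in>u ` I. c v = 0" using ind[of "\<lambda>i. c (u i)"] by blast
  qed (use fin in simp)
qed

text \<open>
  The lowest part (in powers of \<open>f\<close>) of a relation modulo \<open>Q'\<close> lies in \<open>Q\<close>, hence vanishes;
  then \<open>f\<close> can be cancelled modulo the prime \<open>Q'\<close>.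
\<close>

lemma independent_mod_times_powers:
  fixes Q Q' B :: "('x::finite, 'k::field) mpoly set"
  assumes B: "independent_mod Q B"
    and Q: "ideal Q mpoly_ring"
    and Q': "ideal Q' mpoly_ring" "\<And>f g. f * g \<in> Q' \<Longrightarrow> f \<in> Q' \<or> g \<in> Q'" "Q' \<subseteq> Q"
    and f: "f \<in> Q" "f \<notin> Q'"
  shows "independent_mod Q' ((\<lambda>(v, k). v * f ^ k) ` (B \<times> {..K}))"
    and "card ((\<lambda>(v, k). v * f ^ k) ` (B \<times> {..K})) = card B * Suc K"
proof -
  have finB: "finite B" using B by (simp add: independent_mod_def)
  have vanish: "\<forall>v\<in>B. \<forall>k\<le>K. c v k = 0"
    if "(\<Sum>k\<le>K. (\<Sum>v\<in>B. Poly_Mapping.single 0 (c v k) * v) * f ^ k) \<in> Q'" for c K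
    using that
  proof (induction K arbitrary: c)
    case 0
    then have "(\<Sum>v\<in>B. Poly_Mapping.single 0 (c v 0) * v) \<in> Q" using Q'(3) by auto
    then have "\<forall>v\<in>B. c v 0 = 0" by (rule independent_modD[OF B])
    then show ?case by simp
  next
    case (Suc K)
    define s where "s k = (\<Sum>v\<in>B. Poly_Mapping.single 0 (c v k) * v)" for k
    have split: "(\<Sum>k\<le>Suc K. s k * f ^ k) = s 0 + f * (\<Sum>k\<le>K. s (Suc k) * f ^ k)"
      by (subst sum.atMost_Suc_shift) (simp add: sum_distrib_left mult_ac)
    have "(\<Sum>k\<le>Suc K. s k * f ^ k) \<in> Q'" using Suc.prems by (simp only: s_def)
    then have mem: "s 0 + f * (\<Sum>k\<le>K. s (Suc k) * f ^ k) \<in> Q'" unfolding split .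
    have "(\<Sum>k\<le>K. s (Suc k) * f ^ k) * f \<in> Q"
      by (rule ideal_ring_of_type_algebraD(3)[OF Q f(1)])
    moreover have "s 0 + (\<Sum>k\<le>K. s (Suc k) * f ^ k) * f \<in> Q"
      using mem Q'(3) by (auto simp: mult.commute)
    ultimately have "s 0 \<in> Q"
      using ideal_ring_of_type_algebraD(4)[OF Q] by (metis add_diff_cancel_right')
    then have c0: "\<forall>v\<in>B. c v 0 = 0" unfolding s_def by (rule independent_modD[OF B])
    then have "s 0 = 0" by (simp add: s_def)
    then have "(\<Sum>k\<le>K. s (Suc k) * f ^ k) \<in> Q'" using mem Q'(2) f(2) by auto
    then have "\<forall>v\<in>B. \<forall>k\<le>K. c v (Suc k) = 0" unfolding s_def by (rule Suc.IH)
    then show ?case using c0 by (metis Suc_le_mono not0_implies_Suc)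
  qed
  have ind: "\<forall>i\<in>B \<times> {..K}. c i = 0"
    if *: "(\<Sum>i\<in>B \<times> {..K}. Poly_Mapping.single 0 (c i) * (case i of (v, k) \<Rightarrow> v * f ^ k)) \<in> Q'" for c
  proof -
    have "(\<Sum>i\<in>B \<times> {..K}. Poly_Mapping.single 0 (c i) * (case i of (v, k) \<Rightarrow> v * f ^ k))
        = (\<Sum>v\<in>B. \<Sum>k\<le>K. Poly_Mapping.single 0 (c (v, k)) * (v * f ^ k))"
      by (simp add: sum.cartesian_product case_prod_unfold)
    also have "\<dots> = (\<Sum>k\<le>K. (\<Sum>v\<in>B. Poly_Mapping.single 0 (c (v, k)) * v) * f ^ k)"
      by (subst sum.swap) (simp add: sum_distrib_right mult.assoc)
    finally show ?thesis using vanish[of "\<lambda>v k. c (v, k)" K] * by auto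
  qed
  have fin: "finite (B \<times> {..K})" using finB by simp
  show "independent_mod Q' ((\<lambda>(v, k). v * f ^ k) ` (B \<times> {..K}))"
    by (rule independent_mod_image(1)[OF fin ideal_ring_of_type_algebraD(1)[OF Q'(1)] ind])
  have "card ((\<lambda>(v, k). v * f ^ k) ` (B \<times> {..K})) = card (B \<times> {..K})"
    by (rule independent_mod_image(2)[OF fin ideal_ring_of_type_algebraD(1)[OF Q'(1)] ind])
  then show "card ((\<lambda>(v, k). v * f ^ k) ` (B \<times> {..K})) = card B * Suc K"
    by (simp add: card_cartesian_product)
qed

text \<open>Each exponent is bounded separately, so that the monomials supported on a given face
  fill a box and are easy to count.\<close>

definition exponents_le :: "nat \<Rightarrow> ('x, 'k::zero) mpoly set"
  where "exponents_le L = {f. \<forall>m\<in>Poly_Mapping.keys f. \<forall>i. Poly_Mapping.lookup m i \<le> L}"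

lemma exponents_le_mono: "f \<in> exponents_le L \<Longrightarrow> L \<le> L' \<Longrightarrow> f \<in> exponents_le L'"
  unfolding exponents_le_def by (auto intro: order.trans)

lemma exponents_le_mult:
  assumes "f \<in> exponents_le L" "g \<in> exponents_le L'"
  shows "f * g \<in> exponents_le (L + L')"
  unfolding exponents_le_def
proof (intro CollectI ballI allI)
  fix m i assume "m \<in> Poly_Mapping.keys (f * g)"
  then obtain m1 m2 where "m = m1 + m2" "m1 \<in> Poly_Mapping.keys f" "m2 \<in> Poly_Mapping.keys g"
    using keys_mult[of f g] by blast
  then show "Poly_Mapping.lookup m i \<le> L + L'"
    using assms by (auto simp: exponents_le_def lookup_add intro: add_mono)
qed

lemma exponents_le_power:
  fixes f :: "('x, 'k::comm_semiring_1) mpoly"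
  assumes "f \<in> exponents_le L"
  shows "f ^ k \<in> exponents_le (k * L)"
proof (induction k)
  case 0
  have "Poly_Mapping.keys (1 :: ('x, 'k) mpoly) \<subseteq> {0}" by (simp add: keys_one)
  then show ?case by (auto simp: exponents_le_def)
next
  case (Suc k)
  then show ?case using exponents_le_mult[OF assms Suc] by simp
qed

lemma exists_exponents_le: "\<exists>L. f \<in> exponents_le L" for f :: "('x::finite, 'k::zero) mpoly"
proof
  show "f \<in> exponents_le (\<Sum>m\<in>Poly_Mapping.keys f. \<Sum>i\<in>UNIV. Poly_Mapping.lookup m i)"
    unfolding exponents_le_def
  proof (intro CollectI ballI allI)
    fix m i assume m: "m \<in> Poly_Mapping.keys f"
    have "Poly_Mapping.lookup m i \<le> (\<Sum>i\<in>UNIV. Poly_Mapping.lookup m i)" by (rule member_le_sum) auto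
    also have "\<dots> \<le> (\<Sum>m\<in>Poly_Mapping.keys f. \<Sum>i\<in>UNIV. Poly_Mapping.lookup m i)"
      using m by (intro member_le_sum) auto
    finally show "Poly_Mapping.lookup m i
        \<le> (\<Sum>m\<in>Poly_Mapping.keys f. \<Sum>i\<in>UNIV. Poly_Mapping.lookup m i)" .
  qed
qed

text \<open>Each step down the chain multiplies by the powers up to \<open>K\<close> of an element
  of \<open>Q i\<close> outside \<open>Q (Suc i)\<close>. The constant \<open>\<delta>\<close> adds
  up the exponent bounds of these elements, so it does not depend on \<open>B\<close>,
  \<open>L\<close> or \<open>K\<close>; the comparison of growth rates rests on this
  uniformity.\<close>

lemma independent_mod_prime_chain:
  fixes Q :: "nat \<Rightarrow> ('x::finite, 'k::field) mpoly set"
  assumes Q: "\<And>i. i \<le> m \<Longrightarrow> ideal (Q i) mpoly_ring"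
    and prime: "\<And>i f g. i \<le> m \<Longrightarrow> f * g \<in> Q i \<Longrightarrow> f \<in> Q i \<or> g \<in> Q i"
    and less: "\<And>i. i < m \<Longrightarrow> Q (Suc i) \<subset> Q i"
  shows "\<exists>\<delta>. \<forall>B L K. independent_mod (Q 0) B \<longrightarrow> B \<subseteq> exponents_le L \<longrightarrow>
    (\<exists>B'. independent_mod (Q m) B' \<and> B' \<subseteq> exponents_le (L + \<delta> * K) \<and> card B' = card B * Suc K ^ m)"
  using assms
proof (induction m)
  case 0
  show ?case by (intro exI[of _ 0]) auto
next
  case (Suc m)
  have "\<exists>\<delta>. \<forall>B L K. independent_mod (Q 0) B \<longrightarrow> B \<subseteq> exponents_le L \<longrightarrow>
    (\<exists>B'. independent_mod (Q m) B' \<and> B' \<subseteq> exponents_le (L + \<delta> * K) \<and> card B' = card B * Suc K ^ m)"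
    by (rule Suc.IH; rule Suc.prems) auto
  then obtain \<delta> where \<delta>: "\<And>B L K. independent_mod (Q 0) B \<Longrightarrow> B \<subseteq> exponents_le L \<Longrightarrow>
       \<exists>B'. independent_mod (Q m) B' \<and> B' \<subseteq> exponents_le (L + \<delta> * K) \<and> card B' = card B * Suc K ^ m"
    by blast
  obtain f where f: "f \<in> Q m" "f \<notin> Q (Suc m)" using Suc.prems(3)[of m] by blast
  obtain e where e: "f \<in> exponents_le e" using exists_exponents_le by blast
  show ?case
  proof (intro exI[of _ "\<delta> + e"] allI impI)
    fix B L K assume "independent_mod (Q 0) B" "B \<subseteq> exponents_le L"
    from \<delta>[OF this, of K] obtain B' where B': "independent_mod (Q m) B'"
      "B' \<subseteq> exponents_le (L + \<delta> * K)" "card B' = card B * Suc K ^ m" by blast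
    let ?B = "(\<lambda>(v, k). v * f ^ k) ` (B' \<times> {..K})"
    have "v * f ^ k \<in> exponents_le (L + (\<delta> + e) * K)" if "v \<in> B'" "k \<le> K" for v k
    proof (rule exponents_le_mono[OF exponents_le_mult[OF _ exponents_le_power[OF e]]])
      show "v \<in> exponents_le (L + \<delta> * K)" using that B' by blast
      show "L + \<delta> * K + k * e \<le> L + (\<delta> + e) * K" using that by (simp add: algebra_simps)
    qed
    then have "?B \<subseteq> exponents_le (L + (\<delta> + e) * K)" by auto
    moreover have "independent_mod (Q (Suc m)) ?B" "card ?B = card B' * Suc K"
      using independent_mod_times_powers[OF B'(1) Suc.prems(1)[of m] Suc.prems(1)[of "Suc m"]
          Suc.prems(2)[of "Suc m"] _ f, of K] Suc.prems(3)[of m] by auto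
    ultimately show "\<exists>B''. independent_mod (Q (Suc m)) B'' \<and>
        B'' \<subseteq> exponents_le (L + (\<delta> + e) * K) \<and> card B'' = card B * Suc K ^ Suc m"
      using B'(3) by (intro exI[of _ ?B]) (auto simp: mult_ac)
  qed
qed

lemma lookup_scalar_mult:
  "Poly_Mapping.lookup (Poly_Mapping.single 0 c * f) m = c * Poly_Mapping.lookup f m"
  for f :: "('x, 'k::field) mpoly"
  by (simp add: mult_map_scale_conv_mult[symmetric] map.rep_eq when_def)

lemma restrict_keys_single:
  "restrict_keys A (Poly_Mapping.single n c) = (if n \<in> A then Poly_Mapping.single n c else 0)"
  by (intro poly_mapping_eqI) (simp add: lookup_single when_def)

text \<open>Gives access to the bound on independent sets by spanning sets.\<close>

interpretation mpoly: vector_space "\<lambda>c (f :: ('x, 'k::field) mpoly). Poly_Mapping.single 0 c * f"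
  by standard (simp_all add: algebra_simps single_add mult_single)

section \<open>Counting modulo the Stanley-Reisner ideal and the upper bound for the
  dimension\<close>

context stanley_reisner_ring
begin

text \<open>A monomial with support \<open>G\<close> has its exponents on \<open>G\<close> in
  \<open>{1..L}\<close>, which leaves at most \<open>L ^ card G\<close> choices.\<close>

lemma face_monomials_exponents_le:
  assumes "\<And>G. G \<in> D \<Longrightarrow> card G \<le> e" "1 \<le> L"
  defines "M \<equiv> {m\<in>face_monomials. \<forall>i. Poly_Mapping.lookup m i \<le> L}"
  shows "finite M" "card M \<le> card D * L ^ e"
proof -
  define S where "S G = {m. Poly_Mapping.keys m = G \<and> (\<forall>i. Poly_Mapping.lookup m i \<le> L)}" for G :: "'x set"
  have M: "M = (\<Union>G\<in>D. S G)" by (auto simp: M_def S_def face_monomials_def)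
  have inj: "inj_on (\<lambda>m. restrict (Poly_Mapping.lookup m) G) (S G)" for G
  proof (rule inj_onI, rule poly_mapping_eqI)
    fix m n i assume m: "m \<in> S G" "n \<in> S G"
      "restrict (Poly_Mapping.lookup m) G = restrict (Poly_Mapping.lookup n) G"
    from fun_cong[OF m(3), of i] m(1,2) show "Poly_Mapping.lookup m i = Poly_Mapping.lookup n i"
      by (cases "i \<in> G") (auto simp: S_def in_keys_iff)
  qed
  have sub: "(\<lambda>m. restrict (Poly_Mapping.lookup m) G) ` S G \<subseteq> PiE G (\<lambda>_. {1..L})" for G
    by (auto simp: S_def in_keys_iff Suc_le_eq)
  have fin: "finite (PiE G (\<lambda>_. {1..L}))" for G :: "'x set" by (intro finite_PiE) auto
  have finS: "finite (S G)" for G using inj_on_finite[OF inj sub fin] .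
  then show "finite M" by (simp add: M)
  have "card (S G) \<le> L ^ e" if "G \<in> D" for G
  proof -
    have "card (S G) \<le> card (PiE G (\<lambda>_. {1..L}))" by (rule card_inj_on_le[OF inj sub fin])
    also have "\<dots> = L ^ card G" by (simp add: card_PiE)
    also have "\<dots> \<le> L ^ e" using assms that by (intro power_increasing) auto
    finally show ?thesis .
  qed
  then have "(\<Sum>G\<in>D. card (S G)) \<le> card D * L ^ e" using sum_bounded_above[of D "\<lambda>G. card (S G)" "L ^ e"] by simp
  moreover have "card M \<le> (\<Sum>G\<in>D. card (S G))" unfolding M by (rule card_UN_le) simp
  ultimately show "card M \<le> card D * L ^ e" by simp
qed

text \<open>Passing to normal forms modulo \<open>J\<close> preserves independence and cardinality,
  and moves everything into the span of the face monomials with exponents at most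
  \<open>L\<close>.\<close>

lemma card_independent_mod_le:
  assumes B: "independent_mod J B" "B \<subseteq> exponents_le L"
    and D: "\<And>G. G \<in> D \<Longrightarrow> card G \<le> e" "1 \<le> L"
  shows "card B \<le> card D * L ^ e"
proof -
  define M where "M = {m\<in>face_monomials. \<forall>i. Poly_Mapping.lookup m i \<le> L}"
  note M = face_monomials_exponents_le[OF D, simplified, folded M_def]
  let ?r = "restrict_keys face_monomials :: ('x, 'k) mpoly \<Rightarrow> _"
  let ?T = "(\<lambda>m. Poly_Mapping.single m (1::'k)) ` M"
  have finB: "finite B" using B by (simp add: independent_mod_def)
  have lin: "?r (\<Sum>v\<in>B. Poly_Mapping.single 0 (c v) * v) = (\<Sum>v\<in>B. Poly_Mapping.single 0 (c v) * ?r v)" for c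
    by (intro poly_mapping_eqI)
      (simp add: lookup_sum lookup_scalar_mult)
  have ind: "\<forall>v\<in>B. c v = 0" if "(\<Sum>v\<in>B. Poly_Mapping.single 0 (c v) * ?r v) \<in> {0}" for c
    using that by (intro independent_modD[OF B(1)]) (simp add: mem_J_iff lin)
  have indep: "independent_mod {0} (?r ` B)" "card (?r ` B) = card B"
    using independent_mod_image[OF finB _ ind] by auto
  have "mpoly.independent (?r ` B)"
    using indep(1) unfolding independent_mod_def by (intro mpoly.independent_if_scalars_zero) auto
  moreover have "?r ` B \<subseteq> mpoly.span ?T"
  proof
    fix u assume "u \<in> ?r ` B"
    then obtain v where v: "v \<in> B" "u = ?r v" by blast
    have "Poly_Mapping.single m (Poly_Mapping.lookup u m) \<in> mpoly.span ?T"
      if "m \<in> Poly_Mapping.keys u" for m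
    proof -
      have "m \<in> M" using that v B(2) by (auto simp: M_def keys_restrict_keys exponents_le_def)
      then have "Poly_Mapping.single 0 (Poly_Mapping.lookup u m) * Poly_Mapping.single m 1 \<in> mpoly.span ?T"
        by (intro mpoly.span_scale mpoly.span_base) blast
      then show ?thesis by (simp add: mult_single)
    qed
    then show "u \<in> mpoly.span ?T"
      by (subst mpoly_sum_monomials) (rule mpoly.span_sum)
  qed
  ultimately have "card (?r ` B) \<le> card ?T"
    using mpoly.independent_span_bound[of ?T "?r ` B"] M(1) by simp
  also have "\<dots> \<le> card M" using M(1) by (rule card_image_le)
  finally show ?thesis using indep(2) M(2) by simp
qed

text \<open>Homogeneity is defined through generators. The polynomials all of whose components lie
  in the preimage \<open>Q\<close> form an ideal \<open>Q'\<close>, which contains every homogeneous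
  element of \<open>Q\<close>; hence the image of \<open>Q'\<close> contains
  \<open>P\<close>.\<close>

lemma restrict_degree_mem:
  assumes P: "P \<in> multiproj R (quot_piece d J)" and f: "coset J f \<in> P"
  shows "coset J (restrict_keys {m. deg m = v} f) \<in> P"
proof -
  define Q where "Q = {f. coset J f \<in> P}"
  let ?c = "\<lambda>v. restrict_keys {m. deg m = v} :: ('x, 'k) mpoly \<Rightarrow> _"
  define Q' where "Q' = {f. \<forall>v. ?c v f \<in> Q}"
  have prime: "primeideal P R" and hom: "homogeneous_ideal R (quot_piece d J) P"
    using P by (auto simp: multiproj_def)
  note Q = coset_preimage_prime[OF prime, folded Q_def]
  note QD = ideal_ring_of_type_algebraD[OF Q(1)]
  have add: "restrict_keys A (g + h) = restrict_keys A g + restrict_keys A h" for A and g h :: "('x, 'k) mpoly"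
    by (intro poly_mapping_eqI) (simp add: lookup_add)
  have "ideal Q' mpoly_ring"
  proof (rule ideal_ring_of_type_algebraI)
    have "?c v 0 = 0" for v by (intro poly_mapping_eqI) simp
    then show "0 \<in> Q'" using QD(1) by (simp add: Q'_def)
    show sum: "g + h \<in> Q'" if "g \<in> Q'" "h \<in> Q'" for g h
      using that QD(2) by (simp add: Q'_def add)
    show "r * g \<in> Q'" if g: "g \<in> Q'" for r g
    proof (induction r rule: mpoly_induct)
      case (single m c)
      \<comment> \<open>Multiplication by a monomial shifts degrees: the component of degree
        \<open>v\<close> comes from those \<open>n\<close> with \<open>deg (m + n) = v\<close>,
        which are the monomials of one single degree or do not exist.\<close>
      have shift: "?c v (Poly_Mapping.single m c * h)
          = Poly_Mapping.single m c * restrict_keys {n. deg (m + n) = v} h" for v h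
      proof (induction h rule: mpoly_induct)
        case (single n c')
        show ?case
          by (simp add: mult_single restrict_keys_single)
      qed (simp add: add distrib_left)
      have "?c v (Poly_Mapping.single m c * g) \<in> Q" for v
      proof (cases "\<exists>n. deg (m + n) = v")
        case True
        then obtain n0 where "deg (m + n0) = v" by blast
        then have "{n. deg (m + n) = v} = {n. deg n = deg n0}" by (auto simp: deg_add)
        then show ?thesis using g QD(3) by (simp add: shift Q'_def)
      next
        case False
        then have "restrict_keys {n. deg (m + n) = v} g = 0" by (intro poly_mapping_eqI) simp
        then show ?thesis using QD(1) by (simp add: shift)
      qed
      then show ?case by (simp add: Q'_def)
    next
      case (add r s)
      then show ?case using sum by (simp add: distrib_right)
    qed
  qed
  then have ideal: "ideal (coset J ` Q') R" by (rule ideal_coset_image)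
  have "P \<inter> (\<Union>v. quot_piece d J v) \<subseteq> coset J ` Q'"
  proof
    fix u assume u: "u \<in> P \<inter> (\<Union>v. quot_piece d J v)"
    then obtain w g where g: "g \<in> mpoly_piece d w" "u = coset J g" by (auto simp: quot_piece_eq)
    then have "g \<in> Q" using u by (simp add: Q_def)
    have "?c v g = (if v = w then g else 0)" for v
      using g(1) by (intro poly_mapping_eqI) (auto simp: mpoly_piece_def in_keys_iff)
    then have "g \<in> Q'" using \<open>g \<in> Q\<close> QD(1) by (simp add: Q'_def)
    then show "u \<in> coset J ` Q'" using g by blast
  qed
  then have "P \<subseteq> coset J ` Q'"
    using R.genideal_minimal[OF ideal] hom unfolding homogeneous_ideal_def by metis
  then obtain g where g: "g \<in> Q'" "f - g \<in> J" using f by (auto simp: coset_eq_iff)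
  have "?c v (f - g) \<in> J" using g(2) by (auto simp: J_eq face_ideal_def keys_restrict_keys)
  then have "?c v g + ?c v (f - g) \<in> Q" using g(1) Q(4) QD(2) by (auto simp: Q'_def)
  then show ?thesis unfolding add[symmetric] by (simp add: Q_def)
qed

text \<open>Otherwise every monomial of positive degree in coordinate \<open>j\<close> would contain
  a variable whose class is in \<open>P\<close>, and \<open>P\<close> would contain the irrelevant
  ideal.\<close>

lemma exists_variable_notin:
  assumes P: "P \<in> multiproj R (quot_piece d J)"
  shows "\<exists>i. b i = j \<and> coset J (Poly_Mapping.single (Poly_Mapping.single i 1) 1) \<notin> P"
proof (rule ccontr)
  assume "\<not> ?thesis"
  then have all: "coset J (Poly_Mapping.single (Poly_Mapping.single i 1) 1) \<in> P" if "b i = j" for i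
    using that by blast
  have prime: "primeideal P R" using P by (simp add: multiproj_def)
  note Q = coset_preimage_prime[OF prime]
  have "coset J f \<in> P" if f: "f \<in> mpoly_piece d v" and v: "0 < v $ j" for f v
  proof -
    have "Poly_Mapping.single m (Poly_Mapping.lookup f m) \<in> {f. coset J f \<in> P}"
      if "m \<in> Poly_Mapping.keys f" for m
    proof -
      have "0 < deg m $ j" using f v that by (auto simp: mpoly_piece_def)
      then obtain i where i: "b i = j" "0 < Poly_Mapping.lookup m i"
        unfolding deg_nth by (metis (mono_tags, lifting) mem_Collect_eq neq0_conv sum.neutral)
      have "m - Poly_Mapping.single i 1 + Poly_Mapping.single i 1 = m"
        using i by (intro poly_mapping_eqI) (auto simp: lookup_add lookup_minus lookup_single when_def)
      then have "Poly_Mapping.single m (Poly_Mapping.lookup f m)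
          = Poly_Mapping.single (m - Poly_Mapping.single i 1) (Poly_Mapping.lookup f m)
            * Poly_Mapping.single (Poly_Mapping.single i 1) 1"
        by (simp add: mult_single)
      then show ?thesis
        using ideal_ring_of_type_algebraD(3)[OF Q(1), of "Poly_Mapping.single (Poly_Mapping.single i 1) 1"]
          all[OF i(1)] by simp
    qed
    then have "f \<in> {f. coset J f \<in> P}" by (subst mpoly_sum_monomials) (rule ideal_sum_mem[OF Q(1)])
    then show ?thesis by simp
  qed
  then have "(\<Union>v\<in>{v. \<forall>j. 0 < v $ j}. quot_piece d J v) \<subseteq> P" by (auto simp: quot_piece_eq)
  then have "irrelevant_ideal R (quot_piece d J) \<subseteq> P"
    unfolding irrelevant_ideal_def by (rule R.genideal_minimal[OF primeideal.axioms(1)[OF prime]])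
  then show False using P by (simp add: multiproj_def)
qed

text \<open>Monomials in one chosen variable per block have pairwise different degrees, so the
  homogeneous components of a relation are its single terms. These are nonzero scalars times
  products of elements outside a prime. The exponents run from 0 to \<open>K\<close>.\<close>

lemma exists_independent_monomials:
  assumes P: "P \<in> multiproj R (quot_piece d J)"
  shows "\<exists>B. independent_mod {f. coset J f \<in> P} B \<and> B \<subseteq> exponents_le K \<and> card B = Suc K ^ CARD('p)"
proof -
  have prime: "primeideal P R" using P by (simp add: multiproj_def)
  define Q where "Q = {f. coset J f \<in> P}"
  note Q = coset_preimage_prime[OF prime, folded Q_def]
  obtain y where y: "\<And>j. b (y j) = j" "\<And>j. Poly_Mapping.single (Poly_Mapping.single (y j) 1) 1 \<notin> Q"
    using exists_variable_notin[OF P] unfolding Q_def by (simp add: mem_Collect_eq) metis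
  define e where "e c = (\<Sum>j\<in>UNIV. Poly_Mapping.single (y j) (c $ j))" for c :: "nat ^ 'p"
  have deg_sum: "deg (\<Sum>j\<in>A. Poly_Mapping.single (y j) (c $ j)) = (\<Sum>j\<in>A. deg (Poly_Mapping.single (y j) (c $ j)))"
    for A and c :: "nat ^ 'p"
    by (induction A rule: infinite_finite_induct) (auto simp: deg_add)
  have deg_e: "deg (e c) = c" for c
    unfolding e_def deg_sum vec_eq_iff by (simp add: deg_single_nth y(1))
  have var_power: "Poly_Mapping.single (Poly_Mapping.single (y j) n) 1 \<notin> Q" for j n
  proof (induction n)
    case 0
    then show ?case using Q(2) by simp
  next
    case (Suc n)
    have "Poly_Mapping.single (Poly_Mapping.single (y j) (Suc n)) (1::'k)
        = Poly_Mapping.single (Poly_Mapping.single (y j) 1) 1 * Poly_Mapping.single (Poly_Mapping.single (y j) n) 1"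
      by (simp add: mult_single flip: single_add)
    then show ?case using Q(3) Suc y(2) by metis
  qed
  have "Poly_Mapping.single (\<Sum>j\<in>A. Poly_Mapping.single (y j) (c $ j)) 1 \<notin> Q" for A and c :: "nat ^ 'p"
  proof (induction A rule: infinite_finite_induct)
    case (insert j A)
    have "Poly_Mapping.single (\<Sum>j\<in>insert j A. Poly_Mapping.single (y j) (c $ j)) (1::'k)
        = Poly_Mapping.single (Poly_Mapping.single (y j) (c $ j)) 1
          * Poly_Mapping.single (\<Sum>j\<in>A. Poly_Mapping.single (y j) (c $ j)) 1"
      using insert by (simp add: mult_single)
    then show ?case using Q(3) insert.IH var_power[of j "c $ j"] by auto
  qed (use Q(2) in auto)
  then have e_notin: "Poly_Mapping.single (e c) 1 \<notin> Q" for c unfolding e_def .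
  define I where "I = {c :: nat ^ 'p. \<forall>j. c $ j < Suc K}"
  have finI: "finite I" unfolding I_def by (rule finite_vec_box)
  have cardI: "card I = Suc K ^ CARD('p)"
  proof -
    have "(\<Prod>j\<in>(UNIV::'p set). \<Sum>n<Suc K. 1::nat) = card I"
      unfolding prod_sum_vec I_def by simp
    then show ?thesis by simp
  qed
  define u :: "nat ^ 'p \<Rightarrow> ('x, 'k) mpoly" where "u c = Poly_Mapping.single (e c) 1" for c
  have ind: "\<forall>c\<in>I. a c = 0" if mem: "(\<Sum>c\<in>I. Poly_Mapping.single 0 (a c) * u c) \<in> Q" for a
  proof (rule ballI, rule ccontr)
    fix c0 assume c0: "c0 \<in> I" "a c0 \<noteq> 0"
    let ?s = "\<Sum>c\<in>I. Poly_Mapping.single 0 (a c) * u c"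
    have "Poly_Mapping.single (e c0) (a c0) = restrict_keys {m. deg m = c0} ?s"
    proof (rule poly_mapping_eqI)
      fix m
      have "Poly_Mapping.lookup ?s m = (\<Sum>c\<in>I. if e c = m then a c else 0)"
        by (simp add: u_def lookup_sum mult_single lookup_single when_def)
      also have "\<dots> = (\<Sum>c\<in>I. if c = c0 then if e c0 = m then a c0 else 0 else 0)" if "deg m = c0"
        using that deg_e by (intro sum.cong) auto
      also have "\<dots> = (if e c0 = m then a c0 else 0)" using finI c0 by simp
      finally have "deg m = c0 \<Longrightarrow> Poly_Mapping.lookup ?s m = (if e c0 = m then a c0 else 0)" .
      then show "Poly_Mapping.lookup (Poly_Mapping.single (e c0) (a c0)) m
          = Poly_Mapping.lookup (restrict_keys {m. deg m = c0} ?s) m"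
        using deg_e by (auto simp: lookup_single when_def)
    qed
    then have "Poly_Mapping.single (e c0) (a c0) \<in> Q"
      using restrict_degree_mem[OF P, of ?s c0] mem by (simp add: Q_def)
    then have "Poly_Mapping.single 0 (inverse (a c0)) * Poly_Mapping.single (e c0) (a c0) \<in> Q"
      by (rule ideal_ring_of_type_algebraD(3)[OF Q(1)])
    then show False using e_notin c0 by (simp add: mult_single)
  qed
  have "u c \<in> exponents_le K" if "c \<in> I" for c
  proof -
    have "Poly_Mapping.lookup (e c) i \<le> K" for i
      using lookup_le_deg[of "e c" i] that by (auto simp: deg_e I_def less_Suc_eq_le intro: order.trans)
    then show ?thesis by (simp add: u_def exponents_le_def)
  qed
  then have "u ` I \<subseteq> exponents_le K" by blast
  moreover have "independent_mod Q (u ` I)" "card (u ` I) = card I"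
    using independent_mod_image[OF finI ideal_ring_of_type_algebraD(1)[OF Q(1)] ind] by auto
  ultimately show ?thesis using cardI unfolding Q_def by metis
qed

definition vanishing_ideal :: "('x, 'k) mpoly set set set \<Rightarrow> ('x, 'k) mpoly set"
  where "vanishing_ideal Y = {f. \<forall>P\<in>Y. coset J f \<in> P}"

text \<open>If \<open>f * g\<close> vanishes on \<open>Y\<close>, then \<open>Y\<close> is the union
  of the closed loci where \<open>f\<close> or \<open>g\<close> vanishes, and irreducibility selects
  one of them.\<close>

lemma vanishing_ideal_prime:
  assumes Y: "irreducible_closed (multiproj_space R (quot_piece d J)) Y"
  shows "ideal (vanishing_ideal Y) mpoly_ring"
    "f * g \<in> vanishing_ideal Y \<Longrightarrow> f \<in> vanishing_ideal Y \<or> g \<in> vanishing_ideal Y"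
    "J \<subseteq> vanishing_ideal Y"
proof -
  let ?M = "multiproj R (quot_piece d J)" and ?X = "multiproj_space R (quot_piece d J)"
  obtain T where T: "T \<subseteq> carrier R" "Y = {P\<in>?M. T \<subseteq> P}"
    using Y by (auto simp: irreducible_closed_def closedin_multiproj_space_iff)
  have prime: "primeideal P R" if "P \<in> Y" for P using that T by (auto simp: multiproj_def)
  note Q = coset_preimage_prime[OF prime]
  have eq: "vanishing_ideal Y = (\<Inter>P\<in>Y. {f. coset J f \<in> P})" by (auto simp: vanishing_ideal_def)
  show "ideal (vanishing_ideal Y) mpoly_ring"
    unfolding eq
  proof (rule S.i_Intersect)
    fix I assume "I \<in> (\<lambda>P. {f. coset J f \<in> P}) ` Y"
    then obtain P where "P \<in> Y" "I = {f. coset J f \<in> P}" by (rule imageE)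
    then show "ideal I mpoly_ring" using coset_preimage_prime(1)[OF prime] by simp
  next
    show "(\<lambda>P. {f. coset J f \<in> P}) ` Y \<noteq> {}"
      using Y by (simp add: irreducible_closed_def)
  qed
  show "J \<subseteq> vanishing_ideal Y" using Q(4) unfolding eq by blast
  show "f \<in> vanishing_ideal Y \<or> g \<in> vanishing_ideal Y" if fg: "f * g \<in> vanishing_ideal Y"
  proof -
    define V where "V h = {P\<in>?M. insert (coset J h) T \<subseteq> P}" for h
    have closed: "closedin ?X (V h)" for h
      unfolding closedin_multiproj_space_iff
    proof (intro exI conjI)
      show "insert (coset J h) T \<subseteq> carrier R" using T(1) by (simp add: carrier_R)
    qed (rule V_def)
    have "Y = V f \<union> V g"
    proof (intro equalityI subsetI)
      fix P assume "P \<in> Y"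
      then have "f * g \<in> {f. coset J f \<in> P}" using fg by (simp add: vanishing_ideal_def)
      from Q(3)[OF \<open>P \<in> Y\<close> this] \<open>P \<in> Y\<close> show "P \<in> V f \<union> V g" by (auto simp: V_def T(2))
    qed (auto simp: V_def T(2))
    then have "Y = V f \<or> Y = V g" using Y closed unfolding irreducible_closed_def by blast
    then show ?thesis by (auto simp: vanishing_ideal_def V_def)
  qed
qed

text \<open>A closed set is recovered from its vanishing ideal, because that ideal contains
  representatives of the equations \<open>T\<close> defining it.\<close>

lemma vanishing_ideal_strict_antimono:
  assumes Y: "closedin (multiproj_space R (quot_piece d J)) Y"
    and Y': "closedin (multiproj_space R (quot_piece d J)) Y'" and "Y \<subset> Y'"
  shows "vanishing_ideal Y' \<subset> vanishing_ideal Y"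
proof
  show "vanishing_ideal Y' \<subseteq> vanishing_ideal Y" using assms(3) by (auto simp: vanishing_ideal_def)
  show "vanishing_ideal Y' \<noteq> vanishing_ideal Y"
  proof
    assume eq: "vanishing_ideal Y' = vanishing_ideal Y"
    obtain T where T: "T \<subseteq> carrier R" "Y = {P\<in>multiproj R (quot_piece d J). T \<subseteq> P}"
      using Y by (auto simp: closedin_multiproj_space_iff)
    have "Y' \<subseteq> Y"
    proof
      fix P assume P: "P \<in> Y'"
      have "u \<in> P" if "u \<in> T" for u
      proof -
        from that T(1) obtain f where f: "u = coset J f" by (auto simp: carrier_R)
        then have "f \<in> vanishing_ideal Y" using that T(2) by (auto simp: vanishing_ideal_def)
        then show ?thesis using eq P f by (auto simp: vanishing_ideal_def)
      qed
      moreover have "P \<in> multiproj R (quot_piece d J)"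
        using P Y' by (auto simp: closedin_multiproj_space_iff)
      ultimately show "P \<in> Y" using T(2) by blast
    qed
    then show False using assms(3) by blast
  qed
qed

text \<open>The vanishing ideals decrease along the chain. A point of the smallest set
  \<open>Y 0\<close> supplies the factor \<open>Suc K ^ CARD('p)\<close>, and the \<open>m\<close>
  strict inclusions supply \<open>Suc K ^ m\<close>. If the total exponent exceeded
  \<open>e\<close>, the counting bound would fail for large \<open>K\<close>.\<close>

lemma chain_length_le:
  assumes Y: "\<And>i. i \<le> m \<Longrightarrow> irreducible_closed (multiproj_space R (quot_piece d J)) (Y i)"
    and less: "\<And>i. i < m \<Longrightarrow> Y i \<subset> Y (Suc i)"
    and D: "\<And>G. G \<in> D \<Longrightarrow> card G \<le> e"
  shows "m + CARD('p) \<le> e"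
proof (rule ccontr)
  assume "\<not> ?thesis"
  then have e: "Suc e \<le> m + CARD('p)" by simp
  define Q where "Q i = vanishing_ideal (Y i)" for i
  note prime = vanishing_ideal_prime[OF Y, folded Q_def]
  have Q_less: "Q (Suc i) \<subset> Q i" if "i < m" for i
    unfolding Q_def using that Y[of i] Y[of "Suc i"] less[OF that]
    by (intro vanishing_ideal_strict_antimono) (auto simp: irreducible_closed_def)
  obtain \<delta> where \<delta>: "\<And>B L K. independent_mod (Q 0) B \<Longrightarrow> B \<subseteq> exponents_le L \<Longrightarrow>
      \<exists>B'. independent_mod (Q m) B' \<and> B' \<subseteq> exponents_le (L + \<delta> * K) \<and> card B' = card B * Suc K ^ m"
    using independent_mod_prime_chain[of m Q, OF prime(1,2) Q_less] by metis
  have "closedin (multiproj_space R (quot_piece d J)) (Y 0)" "Y 0 \<noteq> {}"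
    using Y[of 0] by (auto simp: irreducible_closed_def)
  then obtain P where P: "P \<in> Y 0" "P \<in> multiproj R (quot_piece d J)"
    by (auto simp: closedin_multiproj_space_iff)
  have Q0: "Q 0 \<subseteq> {f. coset J f \<in> P}" using P by (auto simp: Q_def vanishing_ideal_def)
  \<comment> \<open>Independent of \<open>K\<close>: the counting bound at
    \<open>K + \<delta> * K\<close> equals \<open>C * K ^ e\<close>.\<close>
  define C where "C = card D * Suc \<delta> ^ e"
  have bound: "Suc K \<le> C" if K: "1 \<le> K" for K
  proof -
    obtain B where B: "independent_mod {f. coset J f \<in> P} B" "B \<subseteq> exponents_le K"
        "card B = Suc K ^ CARD('p)"
      using exists_independent_monomials[OF P(2)] by blast
    obtain B' where B': "independent_mod (Q m) B'" "B' \<subseteq> exponents_le (K + \<delta> * K)"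
        "card B' = card B * Suc K ^ m"
      using \<delta>[OF independent_mod_subset[OF B(1) Q0] B(2)] by blast
    have "Suc K ^ Suc e \<le> Suc K ^ (m + CARD('p))" using e by (intro power_increasing) auto
    also have "\<dots> = card B'" using B(3) B'(3) by (simp add: power_add mult.commute)
    also have "\<dots> \<le> card D * (K + \<delta> * K) ^ e"
      using K by (intro card_independent_mod_le[OF independent_mod_subset[OF B'(1) prime(3)] B'(2) D]) auto
    also have "\<dots> = C * K ^ e" by (simp add: C_def flip: power_mult_distrib)
    also have "\<dots> \<le> C * Suc K ^ e" by (intro mult_left_mono power_mono) auto
    finally show ?thesis by (simp only: power_Suc mult_le_cancel2) simp
  qed
  from bound[of "Suc C"] show False by simp
qed

lemma dim_multiproj_eq:
  assumes F: "F \<in> D" "\<And>j. 0 < block_card F j" and max: "\<And>G. G \<in> D \<Longrightarrow> card G \<le> card F"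
  shows "dim_multiproj d J = ereal (real (card F - CARD('p)))"
proof (rule antisym)
  show "dim_multiproj d J \<le> ereal (real (card F - CARD('p)))"
    unfolding dim_multiproj_def krull_dim_def
  proof (rule Sup_least)
    fix x
    assume "x \<in> {ereal (real m) | m. \<exists>Y. (\<forall>i\<le>m. irreducible_closed (multiproj_space R (quot_piece d J)) (Y i))
        \<and> (\<forall>i<m. Y i \<subset> Y (Suc i))}"
    then obtain m Y where x: "x = ereal (real m)"
      and "\<And>i. i \<le> m \<Longrightarrow> irreducible_closed (multiproj_space R (quot_piece d J)) (Y i)"
      and "\<And>i. i < m \<Longrightarrow> Y i \<subset> Y (Suc i)" by blast
    then have "m + CARD('p) \<le> card F" by (intro chain_length_le[of m Y] max)
    then show "x \<le> ereal (real (card F - CARD('p)))" unfolding x by simp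
  qed
qed (rule dim_multiproj_ge[OF F])

end

section \<open>Lattice paths\<close>

text \<open>Induction on the total distance to \<open>a\<close>: some coordinate is still too small,
  and raising it by one stays below \<open>a\<close>.\<close>

lemma increasing_lattice_path_exists:
  fixes n a :: "nat ^ 'p::finite"
  assumes "\<And>j. n $ j \<le> a $ j"
  shows "\<exists>as. increasing_lattice_path as n a"
  using assms
proof (induction "\<Sum>j\<in>UNIV. a $ j - n $ j" arbitrary: n)
  case 0
  then have "n = a" by (auto simp: vec_eq_iff intro: antisym)
  then show ?case by (intro exI[of _ "[a]"]) (simp add: increasing_lattice_path_def)
next
  case (Suc k)
  have "\<exists>j. a $ j - n $ j \<noteq> 0"
  proof (rule ccontr)
    assume "\<not> ?thesis"
    then have "(\<Sum>j\<in>UNIV. a $ j - n $ j) = 0" by simp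
    then show False using Suc.hyps(2) by simp
  qed
  then obtain j where "a $ j - n $ j \<noteq> 0" by blast
  then have j: "n $ j < a $ j" by simp
  let ?n = "n + axis j 1"
  have nth: "?n $ i = (if i = j then Suc (n $ i) else n $ i)" for i by (simp add: axis_def)
  have "(\<Sum>i\<in>UNIV. a $ i - n $ i) = (a $ j - n $ j) + (\<Sum>i\<in>UNIV - {j}. a $ i - n $ i)"
    by (rule sum.remove) auto
  moreover have "(\<Sum>i\<in>UNIV. a $ i - ?n $ i) = (a $ j - Suc (n $ j)) + (\<Sum>i\<in>UNIV - {j}. a $ i - n $ i)"
    unfolding nth by (subst sum.remove[of _ j]) (auto intro!: sum.cong)
  ultimately have "k = (\<Sum>i\<in>UNIV. a $ i - ?n $ i)" using j Suc.hyps(2) by simp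
  moreover have "?n $ i \<le> a $ i" for i using j Suc.prems[of i] unfolding nth by auto
  ultimately obtain as where as: "increasing_lattice_path as ?n a" using Suc.hyps(1) by blast
  have "\<exists>i. (n # as) ! Suc l = (n # as) ! l + axis i 1" if "Suc l < length (n # as)" for l
  proof (cases l)
    case 0
    then show ?thesis using as by (auto simp: increasing_lattice_path_def hd_conv_nth)
  next
    case (Suc l')
    then show ?thesis using as that by (simp add: increasing_lattice_path_def)
  qed
  then have "increasing_lattice_path (n # as) n a"
    using as by (auto simp: increasing_lattice_path_def)
  then show ?case by blast
qed

section \<open>Passing from a face to a facet, and the resulting lattice path\<close>

lemma exists_facet_superset:
  fixes D :: "'x::finite set set"
  assumes "G \<in> D"
  shows "\<exists>F\<in>facets D. G \<subseteq> F"
proof -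
  have "finite D" by simp
  then obtain F where "F \<in> D" "G \<subseteq> F" "\<And>H. H \<in> D \<Longrightarrow> F \<subseteq> H \<Longrightarrow> H = F"
    using finite_has_maximal2[of D G] assms by metis
  then show ?thesis unfolding facets_def by blast
qed

theorem corollary4p10:
  fixes d :: "'x::finite \<Rightarrow> nat ^ 'p::finite"
    and J :: "('x, 'k::field) mpoly set"
  assumes "standard_grading d"
    and "squarefree_monomial_ideal J"
    and "shellable (stanley_reisner_complex J)"
  shows "\<forall>n\<in>HSupp d J. \<exists>a\<in>MSupp d J. \<exists>as. increasing_lattice_path as n a"
proof
  fix n assume n: "n \<in> HSupp d J"
  obtain b where b: "\<And>i. d i = axis (b i) 1"
    using assms(1) unfolding standard_grading_def by metis
  define D where "D = stanley_reisner_complex J"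
  interpret stanley_reisner_ring d b D J
    by unfold_locales (use b stanley_reisner[OF assms(2)] in \<open>auto simp: D_def\<close>)
  have "face_coeff D n \<noteq> 0" using n by (simp add: HSupp_def multidegree_eq)
  then obtain G where G: "G \<in> D" "\<And>j. n $ j < block_card G j"
    using face_coeff_nonzeroE by metis
  obtain F where F: "F \<in> facets D" "G \<subseteq> F" using exists_facet_superset[OF G(1)] by blast
  then have FD: "F \<in> D" by (simp add: facets_def)
  have less: "n $ j < block_card F j" for j
    using G(2)[of j] block_card_mono[OF F(2), of j] by simp
  then have pos: "0 < block_card F j" for j by (metis gr_zeroI not_less_zero)
  \<comment> \<open>Purity: \<open>H\<close> lies in a facet, and all facets have the size of
    \<open>F\<close>.\<close>
  have max: "card H \<le> card F" if H: "H \<in> D" for H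
  proof -
    obtain e where e: "pure_of_dim D e" using assms(3) by (auto simp: shellable_def D_def)
    obtain F' where F': "F' \<in> facets D" "H \<subseteq> F'" using exists_facet_superset[OF H] by blast
    have "face_dim F' = face_dim F" using e F F' by (simp add: pure_of_dim_def)
    then have "card F' = card F" by (simp add: face_dim_def)
    then show ?thesis using card_mono[OF finite F'(2)] by simp
  qed
  \<comment> \<open>The greatest point strictly below the block sizes of \<open>F\<close>; it lies
    above \<open>n\<close>, and its total is the dimension.\<close>
  define a where "a = (\<chi> j. block_card F j - 1)"
  have "a \<in> HSupp d J"
    using face_coeff_facet_pos[OF FD pos max] by (simp add: HSupp_def multidegree_eq a_def)
  moreover have "(\<Sum>j\<in>UNIV. a $ j) = card F - CARD('p)"
  proof -
    \<comment> \<open>Adding 1 in each coordinate undoes the truncated subtraction, since all block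
      sizes are positive.\<close>
    have "(\<Sum>j\<in>UNIV. a $ j) + CARD('p) = (\<Sum>j\<in>UNIV. a $ j + 1)" by (simp only: sum.distrib) simp
    also have "\<dots> = (\<Sum>j\<in>UNIV. block_card F j)" using pos by (intro sum.cong) (simp_all add: a_def)
    finally show ?thesis by (simp add: sum_block_card)
  qed
  ultimately have "a \<in> MSupp d J" by (simp add: MSupp_def dim_multiproj_eq[OF FD pos max] del: of_nat_sum)
  moreover have "n $ j \<le> a $ j" for j using less[of j] by (simp add: a_def)
  ultimately show "\<exists>a\<in>MSupp d J. \<exists>as. increasing_lattice_path as n a"
    using increasing_lattice_path_exists by blast
qed

end
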